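(* Let $(M,F,g)$ be an $(\alpha,\varepsilon)$-metric manifold with $\alpha=+1$, and let $\phi(\cdot,\cdot)=g(F\cdot,\cdot)$ be its fundamental tensor. On $\mathbb TM=TM\oplus T^*M$ put, for $b\in\{g,\phi\}$ and $\lambda\in\{+1,-1\}$, $$\mathcal J_b=\begin{pmatrix}0&-\sharp_b\\ \flat_b&0\end{pmatrix},\quad \mathcal F_b=\begin{pmatrix}0&\sharp_b\\ \flat_b&0\end{pmatrix},\quad \mathcal F_{\lambda,F}=\begin{pmatrix}F&0\\0&\lambda F^*\end{pmatrix}.$$ Then the following are generalized triple structures: $(\mathcal F_g,\mathcal F_{\varepsilon,F},\mathcal F_\phi)$ is a generalized almost hyperproduct structure; $(\mathcal F_g,\mathcal F_{-\varepsilon,F},\mathcal J_\phi)$ is a generalized almost biparacomplex structure; $(\mathcal F_\phi,\mathcal F_{-\varepsilon,F},\mathcal J_g)$ is a generalized almost biparacomplex structure; and $(\mathcal J_g,\mathcal J_\phi,-\mathcal F_{\varepsilon,F})$ is a generalized almost bicomplex structure.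
   Context: An $(\alpha,\varepsilon)$-metric manifold $(M,F,g)$, $\alpha,\varepsilon\in\{+1,-1\}$, is a smooth manifold with a Riemannian or pseudo-Riemannian metric $g$ and an $\mathfrak F(M)$-linear $F\colon\mathfrak X(M)\to\mathfrak X(M)$ with $F^2=\alpha Id$ and $g(FX,FY)=\varepsilon g(X,Y)$ for all $X,Y$. $\mathfrak F(M)$, $\mathfrak X(M)$, $\Lambda^1(M)$ denote smooth functions, vector fields, 1-forms; sections of $\mathbb TM$ are written $X+\xi$. For a nondegenerate bilinear form $b$ on $M$: $(\flat_bX)(Y)=b(X,Y)$, $\sharp_b=\flat_b^{-1}$. $(F^*\xi)(X)=\xi(FX)$. Matrix notation: $\begin{pmatrix}H&\sigma\\ \tau&K\end{pmatrix}(X+\xi)=(HX+\sigma\xi)+(\tau X+K\xi)$. A generalized triple structure $(\mathcal A,\mathcal B,\mathcal C)$ consists of $\mathfrak F(M)$-linear endomorphisms of $\Gamma(\mathbb TM)$, each with square $Id$ (almost product) or $-Id$ (almost complex), such that $\mathcal B\mathcal A=\pm\mathcal A\mathcal B$ and $\mathcal C=\mathcal A\mathcal B$. It is generalized almost hyperproduct if $\mathcal A^2=\mathcal B^2=\mathcal C^2=Id$ and the three pairwise commute; generalized almost bicomplex if $\mathcal A^2=\mathcal B^2=-Id$, $\mathcal C^2=Id$ and the three pairwise commute; generalized almost biparacomplex if $\mathcal A^2=\mathcal B^2=Id$, $\mathcal C^2=-Id$ and the three pairwise anti-commute. *)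

theory Defs
  imports "HOL-Analysis.Analysis" "HOL-Library.Function_Algebras" "HOL-Library.Product_Plus"
begin

text \<open>
  Conventions. A manifold is given by a topology \<open>M\<close> and an atlas \<open>A\<close> with values in a Euclidean
  space; smoothness of functions depends only on the smooth structure generated by \<open>A\<close>, so \<open>A\<close> is
  not required to be maximal. Vector fields are the derivations of the algebra of smooth functions,
  and 1-forms, like all other tensor fields, are multilinear over smooth functions (the definitions
  used e.g. in Helgason's \<^emph>\<open>Differential Geometry, Lie Groups, and Symmetric Spaces\<close>).
  All these objects are total functions in HOL; they are normalised to be \<open>0\<close> off their domain,
  so that equality is the intended one and the pointwise operations of function types
  (\<open>+\<close>, \<open>-\<close>, \<open>*\<close>, \<open>0\<close>) are the operations of the ring of smooth functions and its modules.
\<close>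

type_synonym ('a, 'e) chart = "'a set \<times> ('a \<Rightarrow> 'e)"
type_synonym 'a sfun = "'a \<Rightarrow> real"
type_synonym 'a vfield = "'a sfun \<Rightarrow> 'a sfun"
type_synonym 'a oneform = "'a vfield \<Rightarrow> 'a sfun"
type_synonym 'a gsection = "'a vfield \<times> 'a oneform"


section \<open>Smooth manifolds\<close>

text \<open>Only meant for open \<open>S\<close>.\<close>

primrec Ck_on :: "nat \<Rightarrow> 'e::real_normed_vector set \<Rightarrow> ('e \<Rightarrow> 'f::real_normed_vector) \<Rightarrow> bool" where
  "Ck_on 0 S f \<longleftrightarrow> continuous_on S f"
| "Ck_on (Suc k) S f \<longleftrightarrow>
     (\<forall>x\<in>S. f differentiable (at x)) \<and> (\<forall>v. Ck_on k S (\<lambda>x. frechet_derivative f (at x) v))"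

definition smooth_on :: "'e::real_normed_vector set \<Rightarrow> ('e \<Rightarrow> 'f::real_normed_vector) \<Rightarrow> bool" where
  "smooth_on S f \<longleftrightarrow> (\<forall>k. Ck_on k S f)"

definition chart_on :: "'a topology \<Rightarrow> ('a, 'e::euclidean_space) chart \<Rightarrow> bool" where
  "chart_on M = (\<lambda>(U, c). openin M U \<and> open (c ` U) \<and>
     homeomorphic_map (subtopology M U) (top_of_set (c ` U)) c)"

definition smooth_manifold :: "'a topology \<Rightarrow> ('a, 'e::euclidean_space) chart set \<Rightarrow> bool" where
  "smooth_manifold M A \<longleftrightarrow>
     Hausdorff_space M \<and> second_countable M \<and>
     (\<forall>\<kappa>\<in>A. chart_on M \<kappa>) \<and> (\<Union>(U, c)\<in>A. U) = topspace M \<and>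
     (\<forall>(U, c)\<in>A. \<forall>(V, d)\<in>A. smooth_on (c ` (U \<inter> V)) (d \<circ> inv_into U c))"


section \<open>Functions, vector fields, 1-forms and tensors\<close>

definition smooth_functions :: "'a topology \<Rightarrow> ('a, 'e::euclidean_space) chart set \<Rightarrow> 'a sfun set" where
  "smooth_functions M A =
     {f. (\<forall>p. p \<notin> topspace M \<longrightarrow> f p = 0) \<and>
         (\<forall>(U, c)\<in>A. smooth_on (c ` U) (f \<circ> inv_into U c))}"

text \<open>Multiplication of a vector field or a 1-form by a function; a real scalar \<open>a\<close> acts as the
  constant function \<open>\<lambda>_. a\<close>.\<close>

definition fmult :: "'a sfun \<Rightarrow> ('b \<Rightarrow> 'a sfun) \<Rightarrow> ('b \<Rightarrow> 'a sfun)" (infixr "\<cdot>\<^sub>F" 75) where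
  "f \<cdot>\<^sub>F T = (\<lambda>x. f * T x)"

definition vector_fields :: "'a topology \<Rightarrow> ('a, 'e::euclidean_space) chart set \<Rightarrow> 'a vfield set" where
  "vector_fields M A =
     {X. (\<forall>f. f \<notin> smooth_functions M A \<longrightarrow> X f = 0) \<and>
         (\<forall>f\<in>smooth_functions M A. X f \<in> smooth_functions M A) \<and>
         (\<forall>f\<in>smooth_functions M A. \<forall>h\<in>smooth_functions M A. X (f + h) = X f + X h) \<and>
         (\<forall>f\<in>smooth_functions M A. \<forall>a::real. X ((\<lambda>_. a) * f) = (\<lambda>_. a) * X f) \<and>
         (\<forall>f\<in>smooth_functions M A. \<forall>h\<in>smooth_functions M A. X (f * h) = X f * h + f * X h)}"

definition one_forms :: "'a topology \<Rightarrow> ('a, 'e::euclidean_space) chart set \<Rightarrow> 'a oneform set" where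
  "one_forms M A =
     {\<xi>. (\<forall>X. X \<notin> vector_fields M A \<longrightarrow> \<xi> X = 0) \<and>
         (\<forall>X\<in>vector_fields M A. \<xi> X \<in> smooth_functions M A) \<and>
         (\<forall>X\<in>vector_fields M A. \<forall>Y\<in>vector_fields M A. \<xi> (X + Y) = \<xi> X + \<xi> Y) \<and>
         (\<forall>f\<in>smooth_functions M A. \<forall>X\<in>vector_fields M A. \<xi> (f \<cdot>\<^sub>F X) = f * \<xi> X)}"

definition bilinear_form ::
  "'a topology \<Rightarrow> ('a, 'e::euclidean_space) chart set \<Rightarrow> ('a vfield \<Rightarrow> 'a vfield \<Rightarrow> 'a sfun) \<Rightarrow> bool" where
  "bilinear_form M A b \<longleftrightarrow>
     (\<forall>X\<in>vector_fields M A. \<forall>Y\<in>vector_fields M A. b X Y \<in> smooth_functions M A) \<and>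
     (\<forall>X\<in>vector_fields M A. \<forall>Y\<in>vector_fields M A. \<forall>Z\<in>vector_fields M A.
        b (X + Y) Z = b X Z + b Y Z \<and> b X (Y + Z) = b X Y + b X Z) \<and>
     (\<forall>f\<in>smooth_functions M A. \<forall>X\<in>vector_fields M A. \<forall>Y\<in>vector_fields M A.
        b (f \<cdot>\<^sub>F X) Y = f * b X Y \<and> b X (f \<cdot>\<^sub>F Y) = f * b X Y)"

text \<open>Nondegeneracy of the form induced on each tangent space: tangent vectors at \<open>p\<close> are the
  values at \<open>p\<close> of vector fields, and the value of \<open>X\<close> at \<open>p\<close> is the functional \<open>\<lambda>f. X f p\<close>.\<close>

definition nondegenerate ::
  "'a topology \<Rightarrow> ('a, 'e::euclidean_space) chart set \<Rightarrow> ('a vfield \<Rightarrow> 'a vfield \<Rightarrow> 'a sfun) \<Rightarrow> bool" where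
  "nondegenerate M A b \<longleftrightarrow>
     (\<forall>p\<in>topspace M. \<forall>X\<in>vector_fields M A.
        (\<forall>Y\<in>vector_fields M A. b X Y p = 0) \<longrightarrow> (\<forall>f\<in>smooth_functions M A. X f p = 0))"

text \<open>This covers the Riemannian (positive definite) metrics. Some authors require in addition that
  the index be constant, which is automatic on connected manifolds.\<close>

definition pseudo_riemannian_metric ::
  "'a topology \<Rightarrow> ('a, 'e::euclidean_space) chart set \<Rightarrow> ('a vfield \<Rightarrow> 'a vfield \<Rightarrow> 'a sfun) \<Rightarrow> bool" where
  "pseudo_riemannian_metric M A g \<longleftrightarrow>
     bilinear_form M A g \<and>
     (\<forall>X\<in>vector_fields M A. \<forall>Y\<in>vector_fields M A. g X Y = g Y X) \<and>
     nondegenerate M A g"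

definition vfield_endomorphism ::
  "'a topology \<Rightarrow> ('a, 'e::euclidean_space) chart set \<Rightarrow> ('a vfield \<Rightarrow> 'a vfield) \<Rightarrow> bool" where
  "vfield_endomorphism M A F \<longleftrightarrow>
     (\<forall>X\<in>vector_fields M A. F X \<in> vector_fields M A) \<and>
     (\<forall>X\<in>vector_fields M A. \<forall>Y\<in>vector_fields M A. F (X + Y) = F X + F Y) \<and>
     (\<forall>f\<in>smooth_functions M A. \<forall>X\<in>vector_fields M A. F (f \<cdot>\<^sub>F X) = f \<cdot>\<^sub>F F X)"

definition metric_manifold ::
  "real \<Rightarrow> real \<Rightarrow> 'a topology \<Rightarrow> ('a, 'e::euclidean_space) chart set \<Rightarrow>
   ('a vfield \<Rightarrow> 'a vfield) \<Rightarrow> ('a vfield \<Rightarrow> 'a vfield \<Rightarrow> 'a sfun) \<Rightarrow> bool" where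
  "metric_manifold \<alpha> \<epsilon> M A F g \<longleftrightarrow>
     \<alpha> \<in> {1, -1} \<and> \<epsilon> \<in> {1, -1} \<and>
     smooth_manifold M A \<and> pseudo_riemannian_metric M A g \<and> vfield_endomorphism M A F \<and>
     (\<forall>X\<in>vector_fields M A. F (F X) = (\<lambda>_. \<alpha>) \<cdot>\<^sub>F X) \<and>
     (\<forall>X\<in>vector_fields M A. \<forall>Y\<in>vector_fields M A. g (F X) (F Y) = (\<lambda>_. \<epsilon>) * g X Y)"

definition fundamental_tensor ::
  "('a vfield \<Rightarrow> 'a vfield) \<Rightarrow> ('a vfield \<Rightarrow> 'a vfield \<Rightarrow> 'a sfun) \<Rightarrow> 'a vfield \<Rightarrow> 'a vfield \<Rightarrow> 'a sfun" where
  "fundamental_tensor F g = (\<lambda>X Y. g (F X) Y)"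

definition flat ::
  "'a topology \<Rightarrow> ('a, 'e::euclidean_space) chart set \<Rightarrow> ('a vfield \<Rightarrow> 'a vfield \<Rightarrow> 'a sfun) \<Rightarrow>
   'a vfield \<Rightarrow> 'a oneform" where
  "flat M A b X = (\<lambda>Y. if Y \<in> vector_fields M A then b X Y else 0)"

definition sharp ::
  "'a topology \<Rightarrow> ('a, 'e::euclidean_space) chart set \<Rightarrow> ('a vfield \<Rightarrow> 'a vfield \<Rightarrow> 'a sfun) \<Rightarrow>
   'a oneform \<Rightarrow> 'a vfield" where
  "sharp M A b = inv_into (vector_fields M A) (flat M A b)"

definition dual_map ::
  "'a topology \<Rightarrow> ('a, 'e::euclidean_space) chart set \<Rightarrow> ('a vfield \<Rightarrow> 'a vfield) \<Rightarrow>
   'a oneform \<Rightarrow> 'a oneform" where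
  "dual_map M A F \<xi> = (\<lambda>X. if X \<in> vector_fields M A then \<xi> (F X) else 0)"


section \<open>The generalized tangent bundle\<close>

text \<open>The section written \<open>X + \<xi>\<close> on paper is the pair \<open>(X, \<xi>)\<close>.\<close>

definition gsections :: "'a topology \<Rightarrow> ('a, 'e::euclidean_space) chart set \<Rightarrow> 'a gsection set" where
  "gsections M A = vector_fields M A \<times> one_forms M A"

definition block ::
  "('a vfield \<Rightarrow> 'a vfield) \<Rightarrow> ('a oneform \<Rightarrow> 'a vfield) \<Rightarrow>
   ('a vfield \<Rightarrow> 'a oneform) \<Rightarrow> ('a oneform \<Rightarrow> 'a oneform) \<Rightarrow> 'a gsection \<Rightarrow> 'a gsection" where
  "block H \<sigma> \<tau> K = (\<lambda>(X, \<xi>). (H X + \<sigma> \<xi>, \<tau> X + K \<xi>))"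

definition gen_J ::
  "'a topology \<Rightarrow> ('a, 'e::euclidean_space) chart set \<Rightarrow> ('a vfield \<Rightarrow> 'a vfield \<Rightarrow> 'a sfun) \<Rightarrow>
   'a gsection \<Rightarrow> 'a gsection" where
  "gen_J M A b = block 0 (- sharp M A b) (flat M A b) 0"

definition gen_F ::
  "'a topology \<Rightarrow> ('a, 'e::euclidean_space) chart set \<Rightarrow> ('a vfield \<Rightarrow> 'a vfield \<Rightarrow> 'a sfun) \<Rightarrow>
   'a gsection \<Rightarrow> 'a gsection" where
  "gen_F M A b = block 0 (sharp M A b) (flat M A b) 0"

definition gen_diag ::
  "'a topology \<Rightarrow> ('a, 'e::euclidean_space) chart set \<Rightarrow> real \<Rightarrow> ('a vfield \<Rightarrow> 'a vfield) \<Rightarrow>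
   'a gsection \<Rightarrow> 'a gsection" where
  "gen_diag M A l F = block F 0 0 (\<lambda>\<xi>. (\<lambda>_. l) \<cdot>\<^sub>F dual_map M A F \<xi>)"

definition gen_endomorphism ::
  "'a topology \<Rightarrow> ('a, 'e::euclidean_space) chart set \<Rightarrow> ('a gsection \<Rightarrow> 'a gsection) \<Rightarrow> bool" where
  "gen_endomorphism M A T \<longleftrightarrow>
     (\<forall>s\<in>gsections M A. T s \<in> gsections M A) \<and>
     (\<forall>s\<in>gsections M A. \<forall>t\<in>gsections M A. T (s + t) = T s + T t) \<and>
     (\<forall>f\<in>smooth_functions M A. \<forall>s\<in>gsections M A.
        T (f \<cdot>\<^sub>F fst s, f \<cdot>\<^sub>F snd s) = (f \<cdot>\<^sub>F fst (T s), f \<cdot>\<^sub>F snd (T s)))"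

text \<open>Equality of endomorphisms of the module of sections.\<close>

definition gen_eq ::
  "'a topology \<Rightarrow> ('a, 'e::euclidean_space) chart set \<Rightarrow>
   ('a gsection \<Rightarrow> 'a gsection) \<Rightarrow> ('a gsection \<Rightarrow> 'a gsection) \<Rightarrow> bool" where
  "gen_eq M A S T \<longleftrightarrow> (\<forall>s\<in>gsections M A. S s = T s)"

definition generalized_triple_structure ::
  "'a topology \<Rightarrow> ('a, 'e::euclidean_space) chart set \<Rightarrow> ('a gsection \<Rightarrow> 'a gsection) \<Rightarrow>
   ('a gsection \<Rightarrow> 'a gsection) \<Rightarrow> ('a gsection \<Rightarrow> 'a gsection) \<Rightarrow> bool" where
  "generalized_triple_structure M A P Q R \<longleftrightarrow>
     (\<forall>T\<in>{P, Q, R}. gen_endomorphism M A T \<and>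
        (gen_eq M A (T \<circ> T) id \<or> gen_eq M A (T \<circ> T) (- id))) \<and>
     (gen_eq M A (Q \<circ> P) (P \<circ> Q) \<or> gen_eq M A (Q \<circ> P) (- (P \<circ> Q))) \<and>
     gen_eq M A R (P \<circ> Q)"

definition pairwise_commute ::
  "'a topology \<Rightarrow> ('a, 'e::euclidean_space) chart set \<Rightarrow> ('a gsection \<Rightarrow> 'a gsection) \<Rightarrow>
   ('a gsection \<Rightarrow> 'a gsection) \<Rightarrow> ('a gsection \<Rightarrow> 'a gsection) \<Rightarrow> bool" where
  "pairwise_commute M A P Q R \<longleftrightarrow>
     gen_eq M A (P \<circ> Q) (Q \<circ> P) \<and> gen_eq M A (Q \<circ> R) (R \<circ> Q) \<and> gen_eq M A (P \<circ> R) (R \<circ> P)"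

definition pairwise_anticommute ::
  "'a topology \<Rightarrow> ('a, 'e::euclidean_space) chart set \<Rightarrow> ('a gsection \<Rightarrow> 'a gsection) \<Rightarrow>
   ('a gsection \<Rightarrow> 'a gsection) \<Rightarrow> ('a gsection \<Rightarrow> 'a gsection) \<Rightarrow> bool" where
  "pairwise_anticommute M A P Q R \<longleftrightarrow>
     gen_eq M A (P \<circ> Q) (- (Q \<circ> P)) \<and> gen_eq M A (Q \<circ> R) (- (R \<circ> Q)) \<and>
     gen_eq M A (P \<circ> R) (- (R \<circ> P))"

definition generalized_almost_hyperproduct ::
  "'a topology \<Rightarrow> ('a, 'e::euclidean_space) chart set \<Rightarrow> ('a gsection \<Rightarrow> 'a gsection) \<Rightarrow>
   ('a gsection \<Rightarrow> 'a gsection) \<Rightarrow> ('a gsection \<Rightarrow> 'a gsection) \<Rightarrow> bool" where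
  "generalized_almost_hyperproduct M A P Q R \<longleftrightarrow>
     generalized_triple_structure M A P Q R \<and>
     gen_eq M A (P \<circ> P) id \<and> gen_eq M A (Q \<circ> Q) id \<and> gen_eq M A (R \<circ> R) id \<and>
     pairwise_commute M A P Q R"

definition generalized_almost_bicomplex ::
  "'a topology \<Rightarrow> ('a, 'e::euclidean_space) chart set \<Rightarrow> ('a gsection \<Rightarrow> 'a gsection) \<Rightarrow>
   ('a gsection \<Rightarrow> 'a gsection) \<Rightarrow> ('a gsection \<Rightarrow> 'a gsection) \<Rightarrow> bool" where
  "generalized_almost_bicomplex M A P Q R \<longleftrightarrow>
     generalized_triple_structure M A P Q R \<and>
     gen_eq M A (P \<circ> P) (- id) \<and> gen_eq M A (Q \<circ> Q) (- id) \<and> gen_eq M A (R \<circ> R) id \<and>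
     pairwise_commute M A P Q R"

definition generalized_almost_biparacomplex ::
  "'a topology \<Rightarrow> ('a, 'e::euclidean_space) chart set \<Rightarrow> ('a gsection \<Rightarrow> 'a gsection) \<Rightarrow>
   ('a gsection \<Rightarrow> 'a gsection) \<Rightarrow> ('a gsection \<Rightarrow> 'a gsection) \<Rightarrow> bool" where
  "generalized_almost_biparacomplex M A P Q R \<longleftrightarrow>
     generalized_triple_structure M A P Q R \<and>
     gen_eq M A (P \<circ> P) id \<and> gen_eq M A (Q \<circ> Q) id \<and> gen_eq M A (R \<circ> R) (- id) \<and>
     pairwise_anticommute M A P Q R"

end

theory Submission
  imports Defs "Jordan_Normal_Form.Determinant"
begin

text \<open>
  The heart of the matter is that \<open>\<flat>\<^sub>g\<close> maps derivations \<^emph>\<open>onto\<close> the forms that are linear over smooth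
  functions. By Hadamard's lemma a derivation is, near a point, a combination of the coordinate fields
  of a chart (cut off by a bump function), so a linear form and \<open>g\<close> are determined there by their
  values on these fields. Nondegeneracy makes the Gram determinant nonzero at the point, and Cramer's
  rule over the ring of smooth functions solves \<open>g(X, \<cdot>) = \<xi>\<close> locally; the solutions are unique, hence
  glue. Finally \<open>\<sharp>\<^sub>\<phi> = F \<sharp>\<^sub>g\<close>, \<open>\<flat>\<^sub>\<phi> = \<flat>\<^sub>g F\<close> and \<open>\<epsilon> F* = \<flat>\<^sub>g F \<sharp>\<^sub>g\<close>, so that all the operators are words in
  \<open>F\<close>, \<open>\<flat>\<^sub>g\<close>, \<open>\<sharp>\<^sub>g\<close>, and the relations follow from \<open>F\<^sup>2 = Id\<close>.
\<close>

text \<open>Vector fields act on globally defined functions only, and every object is normalised to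
  0 off its domain. Two consequences shape the proof. Local data (coordinates, remainders,
  reciprocals) must be multiplied by a bump and extended by zero before a derivation can act on
  them; the support then has to be closed in the whole manifold, which is where the Hausdorff axiom
  enters. And a nonzero constant is in \<open>smooth_functions M A\<close> only if the manifold is
  the whole type, so constants are handled through the larger ring \<open>smooth_in_charts\<close>
  and the truncated unit \<open>unit_fun\<close>. A derivation is a purely algebraic object, so a
  Taylor estimate of the remainder says nothing about it. The remainder has to be a sum of products
  of smooth functions, to which the Leibniz rule applies; the price is the smoothness of an integral
  depending on a parameter.\<close>

no_notation scalar_prod (infix "\<bullet>" 70)

section \<open>Calculus of smooth maps\<close>

lemma frechet_derivative_cong_open:
  assumes "open S" "x \<in> S" "\<And>x. x \<in> S \<Longrightarrow> f x = g x" "f differentiable at x"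
  shows "(g has_derivative frechet_derivative f (at x)) (at x)"
    and "frechet_derivative g (at x) = frechet_derivative f (at x)"
proof -
  show *: "(g has_derivative frechet_derivative f (at x)) (at x)"
    by (rule has_derivative_transform_within_open[OF _ assms(1-3)])
      (use assms(4) in \<open>simp_all add: frechet_derivative_works[symmetric]\<close>)
  show "frechet_derivative g (at x) = frechet_derivative f (at x)"
    using frechet_derivative_at[OF *] by simp
qed

lemma Ck_on_cong:
  assumes "open S" "\<And>x. x \<in> S \<Longrightarrow> f x = g x" "Ck_on k S f"
  shows "Ck_on k S g"
  using assms(2,3)
proof (induction k arbitrary: f g)
  case 0
  then show ?case using continuous_on_cong by (metis Ck_on.simps(1))
next
  case (Suc k)
  note d = frechet_derivative_cong_open[where f=f and g=g, OF assms(1) _ Suc.prems(1)]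
  show ?case unfolding Ck_on.simps
  proof (intro conjI ballI allI)
    show "g differentiable at x" if "x \<in> S" for x
      using d(1)[OF that _] Suc.prems(2) that by (intro differentiableI) simp
    show "Ck_on k S (\<lambda>x. frechet_derivative g (at x) v)" for v
      by (rule Suc.IH[where f="\<lambda>x. frechet_derivative f (at x) v"])
        (use Suc.prems(2) d(2) in auto)
  qed
qed

text \<open>\<open>Ck_on\<close> speaks of the chosen term \<open>frechet_derivative\<close>. By
  uniqueness of derivatives an explicit formula \<open>f'\<close> may stand in for it on an open
  set; the inductions below go through this rule.\<close>

lemma Ck_on_SucI:
  assumes "open S" "\<And>x. x \<in> S \<Longrightarrow> (f has_derivative f' x) (at x)"
    and "\<And>v. Ck_on k S (\<lambda>x. f' x v)"
  shows "Ck_on (Suc k) S f"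
  unfolding Ck_on.simps
proof (intro conjI ballI allI)
  show "f differentiable at x" if "x \<in> S" for x
    using assms(2)[OF that] by (rule differentiableI)
  show "Ck_on k S (\<lambda>x. frechet_derivative f (at x) v)" for v
    by (rule Ck_on_cong[OF assms(1) _ assms(3)[of v]]) (use frechet_derivative_at[OF assms(2)] in simp)
qed

lemma Ck_on_Suc_has_derivative:
  assumes "Ck_on (Suc k) S f" "x \<in> S"
  shows "(f has_derivative frechet_derivative f (at x)) (at x)"
  using assms by (simp add: frechet_derivative_works[symmetric])

text \<open>The product and chain rules multiply derivatives by the functions themselves, which
  therefore have to be lowered to the same class.\<close>

lemma Ck_on_SucD: "Ck_on (Suc k) S f \<Longrightarrow> Ck_on k S f"
proof (induction k arbitrary: f)
  case 0
  then show ?case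
    by (auto intro!: continuous_at_imp_continuous_on differentiable_imp_continuous_within)
next
  case (Suc k)
  from Suc.prems show ?case unfolding Ck_on.simps(2)[of "Suc k"] Ck_on.simps(2)[of k S f] 
    using Suc.IH by blast
qed

lemma Ck_on_continuous: "Ck_on k S f \<Longrightarrow> continuous_on S f"
  by (induction k) (use Ck_on_SucD in \<open>auto simp del: Ck_on.simps(2)\<close>)

lemma Ck_on_subset: "Ck_on k S f \<Longrightarrow> T \<subseteq> S \<Longrightarrow> Ck_on k T f"
  by (induction k arbitrary: f) (auto intro: continuous_on_subset)

text \<open>The differentiability clauses of \<open>Ck_on\<close> use the filter
  \<open>at x\<close>, which does not depend on the set; for the continuity clause the openness of
  \<open>T\<close> makes up for the difference.\<close>

lemma Ck_on_local:
  assumes "\<And>x. x \<in> S \<Longrightarrow> \<exists>T. open T \<and> x \<in> T \<and> Ck_on k T f"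
  shows "Ck_on k S f"
  using assms
proof (induction k arbitrary: f)
  case 0
  show ?case unfolding Ck_on.simps
  proof (rule continuous_at_imp_continuous_on, rule ballI)
    fix x assume "x \<in> S"
    with 0 obtain T where "open T" "x \<in> T" "continuous_on T f" by force
    then show "isCont f x" by (simp add: continuous_on_eq_continuous_at)
  qed
next
  case (Suc k)
  show ?case unfolding Ck_on.simps
  proof (intro conjI ballI allI)
    show "f differentiable at x" if "x \<in> S" for x
      using Suc.prems[OF that] by auto
    show "Ck_on k S (\<lambda>x. frechet_derivative f (at x) v)" for v
      using Suc.prems by (intro Suc.IH) force
  qed
qed

lemma Ck_on_const: "open S \<Longrightarrow> Ck_on k S (\<lambda>_. c)"
proof (induction k arbitrary: c)
  case (Suc k)
  then show ?case by (intro Ck_on_SucI[where f'="\<lambda>_ _. 0"]) auto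
qed simp

lemma Ck_on_bounded_linear:
  assumes "open S" "bounded_linear L" "Ck_on k S f"
  shows "Ck_on k S (\<lambda>x. L (f x))"
  using assms(3)
proof (induction k arbitrary: f)
  case 0
  then show ?case
    by (simp add: bounded_linear.continuous_on[OF assms(2)])
next
  case (Suc k)
  show ?case
  proof (rule Ck_on_SucI[OF assms(1)])
    show "((\<lambda>x. L (f x)) has_derivative (\<lambda>v. L (frechet_derivative f (at x) v))) (at x)" if "x \<in> S" for x
      using bounded_linear.has_derivative[OF assms(2) Ck_on_Suc_has_derivative[OF Suc.prems that]] .
    show "Ck_on k S (\<lambda>x. L (frechet_derivative f (at x) v))" for v
      using Suc by simp
  qed
qed

lemma Ck_on_id: "open S \<Longrightarrow> Ck_on k S (\<lambda>x. x)"
proof (induction k)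
  case (Suc k)
  then show ?case
    by (intro Ck_on_SucI[where f'="\<lambda>_ v. v"] Ck_on_const) auto
qed simp

lemma Ck_on_add:
  assumes "open S" "Ck_on k S f" "Ck_on k S g"
  shows "Ck_on k S (\<lambda>x. f x + g x)"
  using assms(2,3)
proof (induction k arbitrary: f g)
  case 0
  then show ?case by (simp add: continuous_on_add)
next
  case (Suc k)
  show ?case
  proof (rule Ck_on_SucI[OF assms(1)])
    show "((\<lambda>x. f x + g x) has_derivative
        (\<lambda>v. frechet_derivative f (at x) v + frechet_derivative g (at x) v)) (at x)" if "x \<in> S" for x
      using Suc.prems that by (intro has_derivative_add Ck_on_Suc_has_derivative)
    show "Ck_on k S (\<lambda>x. frechet_derivative f (at x) v + frechet_derivative g (at x) v)" for v
      using Suc by simp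
  qed
qed

lemma Ck_on_sum:
  assumes "open S" "\<And>i. i \<in> I \<Longrightarrow> Ck_on k S (f i)"
  shows "Ck_on k S (\<lambda>x. \<Sum>i\<in>I. f i x)"
  using assms(2)
  by (induction I rule: infinite_finite_induct) (auto intro: Ck_on_add Ck_on_const assms(1))

lemma Ck_on_mult:
  fixes f g :: "'e::real_normed_vector \<Rightarrow> real"
  assumes "open S" "Ck_on k S f" "Ck_on k S g"
  shows "Ck_on k S (\<lambda>x. f x * g x)"
  using assms(2,3)
proof (induction k arbitrary: f g)
  case 0
  then show ?case by (simp add: continuous_on_mult)
next
  case (Suc k)
  show ?case
  proof (rule Ck_on_SucI[OF assms(1)])
    show "((\<lambda>x. f x * g x) has_derivative
        (\<lambda>v. f x * frechet_derivative g (at x) v + frechet_derivative f (at x) v * g x)) (at x)"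
      if "x \<in> S" for x
      using Suc.prems that by (intro has_derivative_mult Ck_on_Suc_has_derivative)
    show "Ck_on k S (\<lambda>x. f x * frechet_derivative g (at x) v + frechet_derivative f (at x) v * g x)" for v
      using Suc.prems Ck_on_SucD[OF Suc.prems(1)] Ck_on_SucD[OF Suc.prems(2)]
      by (intro Ck_on_add Suc.IH assms(1)) auto
  qed
qed

text \<open>The derivative \<open>Df(g x)(Dg(x) v)\<close> depends on \<open>x\<close> in two
  places, so the induction hypothesis does not apply to it directly. Expanding
  \<open>Dg(x) v\<close> in the basis separates them: a sum of products of its coordinates with
  partial derivatives of \<open>f\<close> composed with \<open>g\<close>.\<close>

lemma Ck_on_compose:
  fixes f :: "'e::euclidean_space \<Rightarrow> real" and g :: "'d::real_normed_vector \<Rightarrow> 'e"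
  assumes "open S" "open T" "g ` S \<subseteq> T" "Ck_on k T f" "Ck_on k S g"
  shows "Ck_on k S (\<lambda>x. f (g x))"
  using assms(4,5)
proof (induction k arbitrary: f)
  case 0
  then show ?case
    using continuous_on_compose2[of T f S g] assms(3) by simp
next
  case (Suc k)
  have lin: "linear (frechet_derivative f (at (g x)))" if "x \<in> S" for x
    by (rule has_derivative_linear[OF Ck_on_Suc_has_derivative[OF Suc.prems(1)]])
      (use that assms(3) in blast)
  show ?case
  proof (rule Ck_on_SucI[OF assms(1)])
    fix x assume x: "x \<in> S"
    have "((\<lambda>x. f (g x)) has_derivative
        (\<lambda>v. frechet_derivative f (at (g x)) (frechet_derivative g (at x) v))) (at x)"
      using has_derivative_compose[OF Ck_on_Suc_has_derivative[OF Suc.prems(2) x]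
          Ck_on_Suc_has_derivative[OF Suc.prems(1)]] x assms(3) by blast
    moreover have "(\<lambda>v. frechet_derivative f (at (g x)) (frechet_derivative g (at x) v)) =
        (\<lambda>v. \<Sum>b\<in>Basis. (frechet_derivative g (at x) v \<bullet> b) * frechet_derivative f (at (g x)) b)"
    proof
      fix v
      show "frechet_derivative f (at (g x)) (frechet_derivative g (at x) v) =
          (\<Sum>b\<in>Basis. (frechet_derivative g (at x) v \<bullet> b) * frechet_derivative f (at (g x)) b)"
        by (subst euclidean_representation[of "frechet_derivative g (at x) v", symmetric])
          (simp add: linear_sum[OF lin[OF x]] linear_scale[OF lin[OF x]] del: euclidean_representation)
    qed
    ultimately show "((\<lambda>x. f (g x)) has_derivative
        (\<lambda>v. \<Sum>b\<in>Basis. (frechet_derivative g (at x) v \<bullet> b) * frechet_derivative f (at (g x)) b)) (at x)"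
      by (rule has_derivative_eq_rhs)
  next
    fix v
    have "Ck_on k S (\<lambda>x. frechet_derivative g (at x) v \<bullet> b)" for b
      using Suc.prems(2) by (intro Ck_on_bounded_linear[OF assms(1) bounded_linear_inner_left]) auto
    moreover have "Ck_on k S (\<lambda>x. frechet_derivative f (at (g x)) b)" for b
      using Suc.prems(1) Ck_on_SucD[OF Suc.prems(2)] by (intro Suc.IH) auto
    ultimately show "Ck_on k S (\<lambda>x. \<Sum>b\<in>Basis. (frechet_derivative g (at x) v \<bullet> b) * frechet_derivative f (at (g x)) b)"
      by (intro Ck_on_sum Ck_on_mult assms(1))
  qed
qed

text \<open>The derivative is a product of \<open>Df\<close> with two copies of \<open>1/f\<close>,
  so the claim one order lower closes the induction.\<close>

lemma Ck_on_inverse: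
  fixes f :: "'e::real_normed_vector \<Rightarrow> real"
  assumes "open S" "\<And>x. x \<in> S \<Longrightarrow> f x \<noteq> 0" "Ck_on k S f"
  shows "Ck_on k S (\<lambda>x. inverse (f x))"
  using assms(3)
proof (induction k)
  case 0
  then show ?case using assms(2) by (simp add: continuous_on_inverse)
next
  case (Suc k)
  show ?case
  proof (rule Ck_on_SucI[OF assms(1)])
    \<comment> \<open>Negation is written as a product with \<open>- 1\<close>, so that the closure
      rules for products and constants suffice.\<close>
    show "((\<lambda>x. inverse (f x)) has_derivative
        (\<lambda>v. - 1 * (inverse (f x) * frechet_derivative f (at x) v * inverse (f x)))) (at x)"
      if "x \<in> S" for x
      using Deriv.has_derivative_inverse[OF assms(2)[OF that] Ck_on_Suc_has_derivative[OF Suc.prems that]]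
      by simp
    show "Ck_on k S (\<lambda>x. - 1 * (inverse (f x) * frechet_derivative f (at x) v * inverse (f x)))" for v
      using Suc.prems Suc.IH Ck_on_SucD[OF Suc.prems]
      by (intro Ck_on_mult assms(1) Ck_on_const) auto
  qed
qed

lemma smooth_on_derivative:
  "smooth_on S f \<Longrightarrow> smooth_on S (\<lambda>x. frechet_derivative f (at x) v)"
  unfolding smooth_on_def by (metis Ck_on.simps(2))

lemma smooth_on_has_derivative:
  "smooth_on S f \<Longrightarrow> x \<in> S \<Longrightarrow> (f has_derivative frechet_derivative f (at x)) (at x)"
  unfolding smooth_on_def by (metis Ck_on_Suc_has_derivative)

lemma smooth_on_subset: "smooth_on S f \<Longrightarrow> T \<subseteq> S \<Longrightarrow> smooth_on T f"
  by (auto simp: smooth_on_def intro: Ck_on_subset[of _ S])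

lemma smooth_on_mult:
  fixes f g :: "'e::real_normed_vector \<Rightarrow> real"
  assumes "open S" "smooth_on S f" "smooth_on S g"
  shows "smooth_on S (\<lambda>x. f x * g x)"
  using assms unfolding smooth_on_def by (intro allI Ck_on_mult) blast+

lemma smooth_on_inverse:
  fixes f :: "'e::real_normed_vector \<Rightarrow> real"
  assumes "open S" "\<And>x. x \<in> S \<Longrightarrow> f x \<noteq> 0" "smooth_on S f"
  shows "smooth_on S (\<lambda>x. inverse (f x))"
  using assms unfolding smooth_on_def by (intro allI Ck_on_inverse) blast+

subsection \<open>Cutoff functions\<close>

text \<open>The function \<open>exp (-1/x) / x^n\<close>, continued by 0. Each derivative is a
  combination of two other members of the family, so smoothness at 0 is one induction over all
  \<open>n\<close>; the cutoff uses \<open>n = 0\<close>.\<close>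

definition flat_exp :: "nat \<Rightarrow> real \<Rightarrow> real" where
  "flat_exp n x = (if x > 0 then exp (- inverse x) * inverse x ^ n else 0)"

lemma flat_exp_deriv:
  "(flat_exp n has_real_derivative flat_exp (n + 2) x - real n * flat_exp (n + 1) x) (at x)"
proof -
  consider "x > 0" | "x < 0" | "x = 0" by linarith
  then show ?thesis
  proof cases
    case 1
    have "((\<lambda>x. exp (- inverse x) * inverse x ^ n) has_real_derivative
        exp (- inverse x) * inverse x ^ (n + 2) - real n * (exp (- inverse x) * inverse x ^ (n + 1))) (at x)"
    proof -
      have "((\<lambda>x. inverse x ^ n) has_real_derivative - (real n * inverse x ^ (n + 1))) (at x)"
        by (rule DERIV_power[OF DERIV_inverse, THEN DERIV_cong])
          (use 1 in \<open>cases n; simp add: algebra_simps\<close>)+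
      moreover have "((\<lambda>x. exp (- inverse x)) has_real_derivative exp (- inverse x) * inverse x ^ 2) (at x)"
        using 1 by (auto intro!: derivative_eq_intros simp: power2_eq_square)
      from DERIV_mult[OF this calculation] show ?thesis
        by (rule DERIV_cong) (simp add: power2_eq_square algebra_simps)
    qed
    then have "(flat_exp n has_real_derivative
        exp (- inverse x) * inverse x ^ (n + 2) - real n * (exp (- inverse x) * inverse x ^ (n + 1))) (at x)"
      by (rule has_field_derivative_transform_within_open[where S="{0<..}"])
        (use 1 in \<open>auto simp: flat_exp_def\<close>)
    with 1 show ?thesis by (simp add: flat_exp_def)
  next
    case 2
    have "((\<lambda>_. 0) has_real_derivative 0) (at x)" by simp
    then have "(flat_exp n has_real_derivative 0) (at x)"
      by (rule has_field_derivative_transform_within_open[where S="{..<0}"])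
        (use 2 in \<open>auto simp: flat_exp_def\<close>)
    with 2 show ?thesis by (simp add: flat_exp_def)
  next
    case 3
    have "((\<lambda>h. flat_exp n h / h) \<longlongrightarrow> 0) (at_left 0)"
      by (rule tendsto_eventually)
        (simp add: flat_exp_def eventually_at_filter)
    moreover have "((\<lambda>h. flat_exp n h / h) \<longlongrightarrow> 0) (at_right 0)"
    proof -
      \<comment> \<open>With \<open>y = 1/h\<close> the right difference quotient at 0 is
        \<open>y^(n+1) exp(-y)\<close>, and the exponential beats the power as \<open>y\<close>
        grows.\<close>
      have "((\<lambda>h. inverse h ^ Suc n / exp (inverse h)) \<longlongrightarrow> (0::real)) (at_right 0)"
        by (rule filterlim_compose[OF tendsto_power_div_exp_0 filterlim_inverse_at_top_right])
      then show ?thesis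
        by (rule Lim_transform_eventually)
          (simp add: flat_exp_def eventually_at_filter exp_minus field_simps)
    qed
    ultimately have "((\<lambda>h. flat_exp n h / h) \<longlongrightarrow> 0) (at 0)"
      by (rule filterlim_split_at)
    with 3 show ?thesis by (simp add: DERIV_def flat_exp_def)
  qed
qed

lemma Ck_on_flat_exp: "Ck_on k UNIV (flat_exp n)"
proof (induction k arbitrary: n)
  case 0
  show ?case
    by (auto intro!: continuous_at_imp_continuous_on DERIV_isCont[OF flat_exp_deriv])
next
  case (Suc k)
  show ?case
  proof (rule Ck_on_SucI)
    show "(flat_exp n has_derivative
        (\<lambda>v. (flat_exp (n + 2) x + - real n * flat_exp (n + 1) x) * v)) (at x)" for x
      using flat_exp_deriv[of n x] by (simp add: has_field_derivative_def)
    show "Ck_on k UNIV (\<lambda>x. (flat_exp (n + 2) x + - real n * flat_exp (n + 1) x) * v)" for v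
      by (intro Ck_on_mult Ck_on_add Suc.IH Ck_on_const) auto
  qed auto
qed

text \<open>With \<open>e = flat_exp 0\<close> and \<open>s\<close> the squared distance to
  \<open>a\<close>, the witness is \<open>e (r^2 - s)\<close> divided by
  \<open>e (r^2 - s) + e (s - (r/2)^2)\<close>. Squaring avoids the singularity of the distance at
  the centre. The two arguments add up to \<open>3 r^2 / 4 > 0\<close>, so one of them is positive
  and the denominator never vanishes.\<close>

lemma smooth_cutoff_exists:
  fixes a :: "'e::euclidean_space"
  assumes "r > 0"
  obtains \<psi> :: "'e \<Rightarrow> real" where "smooth_on UNIV \<psi>" "\<And>x. x \<in> ball a (r / 2) \<Longrightarrow> \<psi> x = 1"
    "\<And>x. x \<notin> cball a r \<Longrightarrow> \<psi> x = 0"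
proof
  define s :: "'e \<Rightarrow> real" where "s = (\<lambda>x. (x - a) \<bullet> (x - a))"
  define \<psi> where "\<psi> = (\<lambda>x. flat_exp 0 (r\<^sup>2 + - 1 * s x) *
     inverse (flat_exp 0 (r\<^sup>2 + - 1 * s x) + flat_exp 0 (s x + - (r / 2)\<^sup>2)))"
  have s_dist: "s x = (dist a x)\<^sup>2" for x
    by (simp add: s_def dist_norm norm_minus_commute[of a] power2_norm_eq_inner)
  have s: "Ck_on k UNIV s" for k
  proof -
    have s': "s = (\<lambda>x. \<Sum>b\<in>Basis. ((x + - a) \<bullet> b) * ((x + - a) \<bullet> b))"
      unfolding s_def by (subst euclidean_inner) simp
    show ?thesis unfolding s'
      by (intro Ck_on_sum Ck_on_mult Ck_on_bounded_linear[OF _ bounded_linear_inner_left]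
          Ck_on_add Ck_on_id Ck_on_const open_UNIV)
  qed
  have pos: "flat_exp 0 (r\<^sup>2 + - 1 * s x) + flat_exp 0 (s x + - (r / 2)\<^sup>2) > 0" for x
  proof -
    have "r\<^sup>2 + - 1 * s x > 0 \<or> s x + - (r / 2)\<^sup>2 > 0"
      using zero_less_power[OF assms, of 2] unfolding power_divide by (simp, linarith)
    then show ?thesis by (auto simp: flat_exp_def add_pos_nonneg add_nonneg_pos)
  qed
  have c: "Ck_on k UNIV (\<lambda>x. flat_exp 0 (t x))" if "Ck_on k UNIV t" for k and t :: "'e \<Rightarrow> real"
    by (rule Ck_on_compose[OF _ _ _ Ck_on_flat_exp that]) auto
  show "smooth_on UNIV \<psi>"
    unfolding smooth_on_def \<psi>_def
    by (intro allI Ck_on_mult Ck_on_inverse Ck_on_add c Ck_on_const s open_UNIV)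
      (use pos in \<open>simp_all add: order_less_imp_not_eq2\<close>)
  show "\<psi> x = 1" if "x \<in> ball a (r / 2)" for x
  proof -
    have "s x \<le> (r / 2)\<^sup>2" unfolding s_dist using that by (intro power_mono) auto
    then have "flat_exp 0 (s x + - (r / 2)\<^sup>2) = 0" by (simp add: flat_exp_def)
    with pos[of x] show ?thesis by (simp add: \<psi>_def)
  qed
  show "\<psi> x = 0" if "x \<notin> cball a r" for x
  proof -
    have "r\<^sup>2 \<le> s x" unfolding s_dist using that assms by (intro power_mono) auto
    then show ?thesis by (simp add: \<psi>_def flat_exp_def)
  qed
qed

subsection \<open>Hadamard's lemma\<close>

text \<open>The chain rule brings out a factor \<open>t\<close>: differentiating in direction
  \<open>v\<close> turns the integral for \<open>(F, n)\<close> into the one for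
  \<open>(DF v, n + 1)\<close>. Hence the weight \<open>t ^ n\<close>, and an induction with
  \<open>F\<close> and \<open>n\<close> arbitrary.\<close>

lemma Ck_on_segment_integral:
  fixes F :: "'e::euclidean_space \<Rightarrow> real"
  assumes "open S" "convex S" "a \<in> S" "Ck_on k S F"
  shows "Ck_on k S (\<lambda>x. integral (cbox 0 1) (\<lambda>t. t ^ n * F (a + t *\<^sub>R (x - a))))"
  using assms(4)
proof (induction k arbitrary: F n)
  have mem: "a + t *\<^sub>R (x - a) \<in> S" if "x \<in> S" "t \<in> cbox 0 1" for x t
    using convexD_alt[OF assms(2,3) that(1), of t] that(2) by (simp add: algebra_simps)
  have cont: "continuous_on (S \<times> cbox 0 1) (\<lambda>z. snd z ^ n * F (a + snd z *\<^sub>R (fst z - a)))"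
    if "continuous_on S F" for F :: "'e \<Rightarrow> real" and n
    by (intro continuous_intros continuous_on_compose2[OF that]) (use mem in auto)
  {
    case (0 F n)
    then show ?case
      using integral_continuous_on_param[of S 0 1 "\<lambda>x t. t ^ n * F (a + t *\<^sub>R (x - a))"] cont[of F n]
      by (simp add: case_prod_unfold)
  next
    case (Suc k F n)
    define D where "D x = frechet_derivative F (at x)" for x
    have D: "(F has_derivative D x) (at x)" if "x \<in> S" for x
      unfolding D_def using Ck_on_Suc_has_derivative[OF Suc.prems that] .
    have D_expand: "D x v = (\<Sum>b\<in>Basis. D x b * (v \<bullet> b))" if "x \<in> S" for x v
    proof -
      note lin = has_derivative_linear[OF D[OF that]]
      show ?thesis
        by (subst euclidean_representation[of v, symmetric])
          (simp add: linear_sum[OF lin] linear_scale[OF lin] mult.commute del: euclidean_representation)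
    qed
    have Ck_D: "Ck_on k S (\<lambda>x. D x v)" for v
      using Suc.prems by (simp add: D_def)
    then have cont_D: "continuous_on S (\<lambda>x. D x v)" for v
      by (rule Ck_on_continuous)
    \<comment> \<open>The Leibniz rule for integrals asks for a derivative with values in bounded
      linear maps, continuous in \<open>(x, t)\<close>. Building it from the coordinate functionals
      reduces this to continuity of the partial derivatives.\<close>
    define fx where "fx x t = (\<Sum>b\<in>Basis. (t ^ Suc n * D (a + t *\<^sub>R (x - a)) b) *\<^sub>R blinfun_inner_left b)"
      for x t
    have fx_apply: "blinfun_apply (fx x t) v = t ^ Suc n * D (a + t *\<^sub>R (x - a)) v"
      if "x \<in> S" "t \<in> cbox 0 1" for x t v
      using D_expand[OF mem[OF that], of v]
      by (simp add: fx_def blinfun.sum_left blinfun.scaleR_left blinfun_inner_left.rep_eq sum_distrib_left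
          mult_ac)
    have cont_fx: "continuous_on (S \<times> cbox 0 1) (\<lambda>(x, t). fx x t)"
      unfolding fx_def case_prod_unfold
      by (intro continuous_on_sum continuous_on_scaleR continuous_on_const cont cont_D)
    have cont_fx': "continuous_on (cbox 0 1) (fx x)" if "x \<in> S" for x
    proof -
      have "continuous_on (cbox 0 1) (\<lambda>t. case (x, t) of (x, t) \<Rightarrow> fx x t)"
        by (rule continuous_on_compose2[OF cont_fx]) (use that in \<open>auto intro!: continuous_intros\<close>)
      then show ?thesis by simp
    qed
    have int_F: "(\<lambda>t. t ^ n * F (a + t *\<^sub>R (x - a))) integrable_on cbox 0 1" if "x \<in> S" for x
    proof (rule integrable_continuous)
      have "continuous_on S F"
        using D by (auto intro!: continuous_at_imp_continuous_on has_derivative_continuous)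
      then have "continuous_on (cbox 0 1) (\<lambda>t. F (a + t *\<^sub>R (x - a)))"
        by (rule continuous_on_compose2) (use mem that in \<open>auto intro!: continuous_intros\<close>)
      then show "continuous_on (cbox 0 1) (\<lambda>t. t ^ n * F (a + t *\<^sub>R (x - a)))"
        by (intro continuous_intros)
    qed
    show ?case
    proof (rule Ck_on_SucI[OF assms(1)])
      fix x assume x: "x \<in> S"
      have "((\<lambda>x. integral (cbox 0 1) (\<lambda>t. t ^ n * F (a + t *\<^sub>R (x - a)))) has_derivative
          integral (cbox 0 1) (fx x)) (at x within S)"
      proof (rule leibniz_rule[OF _ int_F cont_fx x assms(2)])
        fix x t assume xt: "x \<in> S" "t \<in> cbox (0::real) 1"
        have "((\<lambda>x. a + t *\<^sub>R (x - a)) has_derivative (\<lambda>v. t *\<^sub>R v)) (at x within S)"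
          by (auto intro!: derivative_eq_intros)
        from has_derivative_compose[OF this D[OF mem[OF xt]]]
        have "((\<lambda>x. t ^ n * F (a + t *\<^sub>R (x - a))) has_derivative
            (\<lambda>v. t ^ n * D (a + t *\<^sub>R (x - a)) (t *\<^sub>R v))) (at x within S)"
          by (rule has_derivative_mult_right)
        moreover have "(\<lambda>v. t ^ n * D (a + t *\<^sub>R (x - a)) (t *\<^sub>R v)) = blinfun_apply (fx x t)"
          using linear_scale[OF has_derivative_linear[OF D[OF mem[OF xt]]]]
          by (auto simp: fx_apply[OF xt])
        ultimately show "((\<lambda>x. t ^ n * F (a + t *\<^sub>R (x - a))) has_derivative blinfun_apply (fx x t))
            (at x within S)" by simp
      qed
      then show "((\<lambda>x. integral (cbox 0 1) (\<lambda>t. t ^ n * F (a + t *\<^sub>R (x - a)))) has_derivative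
          integral (cbox 0 1) (fx x)) (at x)"
        using at_within_open[OF x assms(1)] by simp
    next
      fix v
      have "blinfun_apply (integral (cbox 0 1) (fx x)) v =
          integral (cbox 0 1) (\<lambda>t. t ^ Suc n * D (a + t *\<^sub>R (x - a)) v)" if "x \<in> S" for x
        unfolding blinfun_apply_integral[OF integrable_continuous[OF cont_fx'[OF that]]]
        by (rule integral_cong) (rule fx_apply[OF that])
      then show "Ck_on k S (\<lambda>x. blinfun_apply (integral (cbox 0 1) (fx x)) v)"
        by (intro Ck_on_cong[OF assms(1) _ Suc.IH[OF Ck_D, of "Suc n" v]]) simp
    qed
  }
qed

text \<open>Integrate the derivative of \<open>f\<close> along the segment from \<open>a\<close> to
  \<open>x\<close> and expand the direction \<open>x - a\<close> in the basis. The coefficients are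
  averages of partial derivatives over the segment, which shrinks to a point when
  \<open>x = a\<close>.\<close>

lemma hadamard:
  fixes f :: "'e::euclidean_space \<Rightarrow> real"
  assumes "open S" "convex S" "a \<in> S" "smooth_on S f"
  obtains h where "\<And>b. smooth_on S (h b)" "\<And>b. h b a = frechet_derivative f (at a) b"
    "\<And>x. x \<in> S \<Longrightarrow> f x = f a + (\<Sum>b\<in>Basis. ((x - a) \<bullet> b) * h b x)"
proof
  define D where "D x = frechet_derivative f (at x)" for x
  \<comment> \<open>The factor \<open>t ^ 0\<close> matches the form of
    \<open>Ck_on_segment_integral\<close> at \<open>n = 0\<close>.\<close>
  define h where "h b x = integral (cbox 0 1) (\<lambda>t. t ^ 0 * D (a + t *\<^sub>R (x - a)) b)" for b x
  have D: "(f has_derivative D x) (at x)" if "x \<in> S" for x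
    unfolding D_def using smooth_on_has_derivative[OF assms(4) that] .
  have smooth_D: "smooth_on S (\<lambda>x. D x b)" for b
    unfolding D_def by (rule smooth_on_derivative[OF assms(4)])
  show "smooth_on S (h b)" for b
    using smooth_D[of b] unfolding smooth_on_def h_def by (intro allI Ck_on_segment_integral assms) simp
  show "h b a = frechet_derivative f (at a) b" for b
    by (simp add: h_def D_def)
  show "f x = f a + (\<Sum>b\<in>Basis. ((x - a) \<bullet> b) * h b x)" if x: "x \<in> S" for x
  proof -
    have mem: "a + t *\<^sub>R (x - a) \<in> S" if "t \<in> {0..1}" for t
      using convexD_alt[OF assms(2,3) x, of t] that by (simp add: algebra_simps)
    have "((\<lambda>t. D (a + t *\<^sub>R (x - a)) (x - a)) has_integral
        f (a + 1 *\<^sub>R (x - a)) - f (a + 0 *\<^sub>R (x - a))) {0..1}"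
    proof (rule fundamental_theorem_of_calculus)
      fix t :: real assume t: "t \<in> {0..1}"
      have "((\<lambda>t. a + t *\<^sub>R (x - a)) has_derivative (\<lambda>s. s *\<^sub>R (x - a))) (at t within {0..1})"
        by (auto intro!: derivative_eq_intros)
      from has_derivative_compose[OF this D[OF mem[OF t]]]
      show "((\<lambda>t. f (a + t *\<^sub>R (x - a))) has_vector_derivative D (a + t *\<^sub>R (x - a)) (x - a))
          (at t within {0..1})"
        using linear_scale[OF has_derivative_linear[OF D[OF mem[OF t]]]]
        by (simp add: has_vector_derivative_def)
    qed simp
    then have "f x - f a = integral {0..1} (\<lambda>t. D (a + t *\<^sub>R (x - a)) (x - a))"
      by (simp add: integral_unique)
    also have "\<dots> = integral {0..1} (\<lambda>t. \<Sum>b\<in>Basis. ((x - a) \<bullet> b) * D (a + t *\<^sub>R (x - a)) b)"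
    proof (rule integral_cong)
      fix t :: real assume "t \<in> {0..1}"
      note lin = has_derivative_linear[OF D[OF mem[OF this]]]
      show "D (a + t *\<^sub>R (x - a)) (x - a) = (\<Sum>b\<in>Basis. ((x - a) \<bullet> b) * D (a + t *\<^sub>R (x - a)) b)"
        by (subst (2) euclidean_representation[of "x - a", symmetric])
          (simp add: linear_sum[OF lin] linear_scale[OF lin] del: euclidean_representation)
    qed
    also have "\<dots> = (\<Sum>b\<in>Basis. ((x - a) \<bullet> b) * integral {0..1} (\<lambda>t. D (a + t *\<^sub>R (x - a)) b))"
    proof (subst integral_sum)
      show "(\<lambda>t. ((x - a) \<bullet> b) * D (a + t *\<^sub>R (x - a)) b) integrable_on {0..1}" for b
      proof (rule integrable_continuous_real, rule continuous_on_mult_left)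
        have "continuous_on S (\<lambda>x. D x b)"
          using smooth_D[of b] unfolding smooth_on_def by (metis Ck_on.simps(1))
        then show "continuous_on {0..1} (\<lambda>t. D (a + t *\<^sub>R (x - a)) b)"
          by (rule continuous_on_compose2) (use mem in \<open>auto intro!: continuous_intros\<close>)
      qed
    qed simp_all
    finally show ?thesis by (simp add: h_def)
  qed
qed

section \<open>Linear systems over a ring of functions\<close>

text \<open>The Leibniz formula is a sum of products of entries and signs. A closed set
  \<open>S\<close> is used instead of a ring type because smooth functions are a subset of a
  function type.\<close>

lemma det_in_subring:
  fixes B :: "'b::comm_ring_1 mat"
  assumes S: "1 \<in> S" "- 1 \<in> S" "\<And>f h. f \<in> S \<Longrightarrow> h \<in> S \<Longrightarrow> f + h \<in> S"
      "\<And>f h. f \<in> S \<Longrightarrow> h \<in> S \<Longrightarrow> f * h \<in> S"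
    and B: "B \<in> carrier_mat n n" "\<And>i j. i < n \<Longrightarrow> j < n \<Longrightarrow> B $$ (i, j) \<in> S"
  shows "det B \<in> S"
proof -
  have "0 \<in> S" using S(3)[OF S(1,2)] by simp
  then have sum: "sum f I \<in> S" if "\<And>i. i \<in> I \<Longrightarrow> f i \<in> S" for f :: "(nat \<Rightarrow> nat) \<Rightarrow> 'b" and I
    using that S(3) by (induction I rule: infinite_finite_induct) auto
  have prod: "prod f I \<in> S" if "\<And>i. i \<in> I \<Longrightarrow> f i \<in> S" for f :: "nat \<Rightarrow> 'b" and I
    using that S(1,4) by (induction I rule: infinite_finite_induct) auto
  have "signof p \<in> S" for p :: "nat \<Rightarrow> nat"
    using S(1,2) by (auto simp: sign_def)
  then show ?thesis
    unfolding det_def'[OF B(1)] using B(2)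
    by (intro sum S(4) prod) (auto dest: permutes_in_image)
qed

text \<open>Cramer's rule without division: \<open>d = det B\<close> and \<open>a = adj B w\<close>
  satisfy \<open>B a = d w\<close> identically, so the coefficients stay in \<open>S\<close>.
  Dividing by \<open>d\<close> is left to a neighbourhood where it has no zero.\<close>

lemma linear_system_solvable_near:
  fixes G :: "nat \<Rightarrow> nat \<Rightarrow> 'a \<Rightarrow> real" and w :: "nat \<Rightarrow> 'a \<Rightarrow> real"
  assumes S: "1 \<in> S" "- 1 \<in> S" "\<And>f h. f \<in> S \<Longrightarrow> h \<in> S \<Longrightarrow> f + h \<in> S"
      "\<And>f h. f \<in> S \<Longrightarrow> h \<in> S \<Longrightarrow> f * h \<in> S"
    and G: "\<And>i j. i < n \<Longrightarrow> j < n \<Longrightarrow> G i j \<in> S" and w: "\<And>i. i < n \<Longrightarrow> w i \<in> S"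
    and inj: "\<And>v. (\<And>i. i < n \<Longrightarrow> (\<Sum>j<n. G i j p * v j) = 0) \<Longrightarrow> (\<And>j. j < n \<Longrightarrow> v j = 0)"
  obtains d a where "d \<in> S" "d p \<noteq> 0" "\<And>j. j < n \<Longrightarrow> a j \<in> S"
    "\<And>i. i < n \<Longrightarrow> (\<Sum>j<n. G i j * a j) = d * w i"
proof
  define B where "B = mat n n (\<lambda>(i, j). G i j)"
  define a where "a j = (\<Sum>k<n. adj_mat B $$ (j, k) * w k)" for j
  have B: "B \<in> carrier_mat n n" by (simp add: B_def)
  have B_S: "B $$ (i, j) \<in> S" if "i < n" "j < n" for i j
    using G that by (simp add: B_def)
  show "det B \<in> S" by (rule det_in_subring[OF S B B_S])
  show "det B p \<noteq> 0"
  proof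
    assume 0: "det B p = 0"
    \<comment> \<open>Evaluation at \<open>p\<close> is a ring homomorphism, so it commutes with
      determinants and leaves a question about a real matrix with trivial kernel.\<close>
    interpret ev: comm_ring_hom "\<lambda>f :: 'a \<Rightarrow> real. f p"
      by unfold_locales auto
    have "det (map_mat (\<lambda>f. f p) B) = 0" using 0 by simp
    then obtain v where v: "v \<in> carrier_vec n" "v \<noteq> 0\<^sub>v n" "map_mat (\<lambda>f. f p) B *\<^sub>v v = 0\<^sub>v n"
      using det_0_iff_vec_prod_zero_field[of "map_mat (\<lambda>f. f p) B" n] B by auto
    have "(\<Sum>j<n. G i j p * v $ j) = 0" if "i < n" for i
    proof -
      have "(\<Sum>j<n. G i j p * v $ j) = (map_mat (\<lambda>f. f p) B *\<^sub>v v) $ i"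
        using that v(1) B by (auto simp: scalar_prod_def B_def lessThan_atLeast0 intro!: sum.cong)
      then show ?thesis using v(3) that by simp
    qed
    then have "v $ j = 0" if "j < n" for j using inj[of "\<lambda>j. v $ j"] that by blast
    then have "v = 0\<^sub>v n" using v(1) by (intro eq_vecI) auto
    with v(2) show False by simp
  qed
  have "adj_mat B $$ (j, k) \<in> S" if "j < n" "k < n" for j k
  proof -
    have "det (mat_delete B k j) \<in> S"
    proof (rule det_in_subring[OF S])
      show "mat_delete B k j \<in> carrier_mat (n - 1) (n - 1)" using B by (rule mat_delete_carrier)
      show "mat_delete B k j $$ (i', j') \<in> S" if "i' < n - 1" "j' < n - 1" for i' j'
        using that B by (auto simp: mat_delete_def intro!: B_S)
    qed
    moreover have "(- 1) ^ m \<in> S" for m :: nat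
      using S(1) S(4)[OF S(2)] by (induction m) (simp_all del: mult_minus_left)
    ultimately show ?thesis
      using S(4) B that by (simp add: adj_mat_def cofactor_def)
  qed
  moreover have "0 \<in> S" using S(3)[OF S(1,2)] by simp
  then have "sum f {..<k} \<in> S" if "\<And>i. i < k \<Longrightarrow> f i \<in> S" for f :: "nat \<Rightarrow> 'a \<Rightarrow> real" and k
    using that S(3) by (induction k) auto
  ultimately show "a j \<in> S" if "j < n" for j
    using that w S(4) by (simp add: a_def)
  show "(\<Sum>j<n. G i j * a j) = det B * w i" if i: "i < n" for i
  proof -
    have "(\<Sum>j<n. G i j * adj_mat B $$ (j, k)) = (if i = k then det B else 0)" if k: "k < n" for k
    proof -
      have "(\<Sum>j<n. G i j * adj_mat B $$ (j, k)) = (B * adj_mat B) $$ (i, k)"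
        using i k B adj_mat(1)[OF B]
        by (auto simp: scalar_prod_def B_def lessThan_atLeast0 intro!: sum.cong)
      then show ?thesis using i k by (simp add: adj_mat(2)[OF B])
    qed
    then have "(\<Sum>k<n. (\<Sum>j<n. G i j * adj_mat B $$ (j, k)) * w k) = (\<Sum>k<n. if i = k then det B * w k else 0)"
      by (intro sum.cong) auto
    moreover have "(\<Sum>j<n. G i j * a j) = (\<Sum>k<n. (\<Sum>j<n. G i j * adj_mat B $$ (j, k)) * w k)"
      unfolding a_def sum_distrib_left sum_distrib_right
      by (subst sum.swap) (simp add: mult.assoc)
    ultimately show ?thesis using i by (simp add: sum.delta)
  qed
qed

section \<open>Smooth functions on a manifold\<close>

text \<open>Vanishing off the manifold is not demanded here, so the constants belong to it: this is
  the ring with unit over which linear systems are solved, and \<open>smooth_functions\<close> is an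
  ideal in it.\<close>

definition smooth_in_charts :: "('a, 'e::euclidean_space) chart set \<Rightarrow> 'a sfun set" where
  "smooth_in_charts A = {f. \<forall>(U, c)\<in>A. smooth_on (c ` U) (f \<circ> inv_into U c)}"

lemma smooth_functions_iff:
  "f \<in> smooth_functions M A \<longleftrightarrow> f \<in> smooth_in_charts A \<and> (\<forall>p. p \<notin> topspace M \<longrightarrow> f p = 0)"
  by (auto simp: smooth_functions_def smooth_in_charts_def)

locale manifold =
  fixes M :: "'a topology" and A :: "('a, 'e::euclidean_space) chart set"
  assumes manifold: "smooth_manifold M A"
begin

abbreviation "C \<equiv> smooth_functions M A"
abbreviation "\<X> \<equiv> vector_fields M A"

section \<open>Topology of charts\<close>

lemma chart:
  assumes "(U, c) \<in> A"
  shows chart_openin: "openin M U" and chart_open_image: "open (c ` U)"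
    and chart_homeomorphic: "homeomorphic_map (subtopology M U) (top_of_set (c ` U)) c"
    and chart_subset: "U \<subseteq> topspace M" and chart_inj: "inj_on c U"
proof -
  have "chart_on M (U, c)" using manifold assms by (auto simp: smooth_manifold_def)
  then show *: "openin M U" "open (c ` U)" and h: "homeomorphic_map (subtopology M U) (top_of_set (c ` U)) c"
    by (auto simp: chart_on_def)
  then show **: "U \<subseteq> topspace M" by (simp add: openin_subset)
  show "inj_on c U"
    using homeomorphic_imp_injective_map[OF h] ** by (simp add: Int_absorb1)
qed

lemma chart_ex:
  assumes "p \<in> topspace M"
  obtains U c where "(U, c) \<in> A" "p \<in> U"
proof -
  have "p \<in> (\<Union>(U, c)\<in>A. U)" using manifold assms by (simp add: smooth_manifold_def)
  then show ?thesis using that by auto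
qed

lemma chart_open_map:
  assumes "(U, c) \<in> A" "openin M W"
  shows "open (c ` (U \<inter> W))"
proof -
  have "openin (subtopology M U) (U \<inter> W)"
    using assms(2) by (simp add: openin_subtopology_Int2)
  then have "openin (top_of_set (c ` U)) (c ` (U \<inter> W))"
    using homeomorphic_imp_open_map[OF chart_homeomorphic[OF assms(1)]] by (simp add: open_map_def)
  then show ?thesis
    using openin_open_trans chart_open_image[OF assms(1)] by blast
qed

lemma chart_vimage_openin:
  assumes "(U, c) \<in> A" "open T"
  shows "openin M {q \<in> U. c q \<in> T}"
proof -
  have "openin (top_of_set (c ` U)) (c ` U \<inter> T)" using assms(2) by auto
  then have "openin (subtopology M U) {q \<in> topspace (subtopology M U). c q \<in> c ` U \<inter> T}"
    using homeomorphic_imp_continuous_map[OF chart_homeomorphic[OF assms(1)]]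
    by (rule openin_continuous_map_preimage[rotated])
  moreover have "{q \<in> topspace (subtopology M U). c q \<in> c ` U \<inter> T} = {q \<in> U. c q \<in> T}"
    using chart_subset[OF assms(1)] by auto
  ultimately show ?thesis
    using openin_trans_full chart_openin[OF assms(1)] by metis
qed

text \<open>Closed in all of \<open>M\<close>, not merely in the chart domain: the preimage of the
  compact \<open>T\<close> is compact, and \<open>M\<close> is Hausdorff. This is what makes
  extension by zero possible.\<close>

lemma chart_vimage_closedin:
  assumes "(U, c) \<in> A" "compact T" "T \<subseteq> c ` U"
  shows "closedin M {q \<in> U. c q \<in> T}"
proof -
  obtain d where d: "homeomorphic_maps (subtopology M U) (top_of_set (c ` U)) c d"
    using chart_homeomorphic[OF assms(1)] homeomorphic_map_maps by blast
  have "d (c q) = q" if "q \<in> U" for q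
    using d that chart_subset[OF assms(1)] by (auto simp: homeomorphic_maps_def)
  then have "d ` T = {q \<in> U. c q \<in> T}" using assms(3) by force
  moreover have "compactin (top_of_set (c ` U)) T"
    using assms(2,3) by (simp add: compactin_subtopology)
  then have "compactin (subtopology M U) (d ` T)"
    using d image_compactin by (metis homeomorphic_maps_def)
  then have "compactin M (d ` T)" by (simp add: compactin_subtopology)
  ultimately show ?thesis
    using manifold compactin_imp_closedin by (metis smooth_manifold_def)
qed

section \<open>Locality of smoothness, extension by zero, bump functions\<close>

lemma chart_inv:
  assumes "(U, c) \<in> A" "q \<in> U"
  shows "inv_into U c (c q) = q"
  using chart_inj[OF assms(1)] assms(2) by simp

text \<open>One chart around each point is enough: in any other chart \<open>f\<close> reads as
  \<open>F\<close> composed with a transition map, which is smooth by compatibility of the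
  atlas.\<close>

lemma smooth_in_charts_locallyI:
  assumes "\<And>p. p \<in> topspace M \<Longrightarrow> \<exists>W U c F. openin M W \<and> p \<in> W \<and> (U, c) \<in> A \<and> W \<subseteq> U \<and>
    smooth_on (c ` W) F \<and> (\<forall>q\<in>W. f q = F (c q))"
  shows "f \<in> smooth_in_charts A"
proof -
  have "smooth_on (d ` V) (f \<circ> inv_into V d)" if V: "(V, d) \<in> A" for V d
    unfolding smooth_on_def
  proof (intro allI Ck_on_local)
    fix k x assume "x \<in> d ` V"
    then obtain p where p: "p \<in> V" "x = d p" by auto
    with assms[of p] chart_subset[OF V] obtain W U c F where W: "openin M W" "p \<in> W" "(U, c) \<in> A"
      "W \<subseteq> U" "smooth_on (c ` W) F" and f: "\<And>q. q \<in> W \<Longrightarrow> f q = F (c q)" by blast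
    define T where "T = d ` (V \<inter> W)"
    have T: "open T" using chart_open_map[OF V W(1)] by (simp add: T_def)
    have "c ` W = c ` (U \<inter> W)" using W(4) by auto
    then have cW: "open (c ` W)" using chart_open_map[OF W(3,1)] by simp
    have "\<forall>(U, c)\<in>A. \<forall>(V, d)\<in>A. smooth_on (c ` (U \<inter> V)) (d \<circ> inv_into U c)"
      using manifold by (simp add: smooth_manifold_def)
    then have "Ck_on k (d ` (V \<inter> U)) (c \<circ> inv_into V d)"
      using V W(3) unfolding smooth_on_def by fast
    then have "Ck_on k T (c \<circ> inv_into V d)"
      by (rule Ck_on_subset) (use W(4) in \<open>auto simp: T_def\<close>)
    moreover have "(c \<circ> inv_into V d) ` T \<subseteq> c ` W"
      by (auto simp: T_def chart_inv[OF V])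
    ultimately have "Ck_on k T (\<lambda>x. F ((c \<circ> inv_into V d) x))"
      using W(5) unfolding smooth_on_def by (intro Ck_on_compose[OF T cW]) blast+
    then have "Ck_on k T (f \<circ> inv_into V d)"
      by (rule Ck_on_cong[OF T, rotated]) (auto simp: T_def chart_inv[OF V] f)
    moreover have "x \<in> T" using p W(2) by (auto simp: T_def)
    ultimately show "\<exists>T. open T \<and> x \<in> T \<and> Ck_on k T (f \<circ> inv_into V d)" using T by blast
  qed
  then show ?thesis by (auto simp: smooth_in_charts_def)
qed

lemma smooth_in_charts_local:
  assumes "\<And>p. p \<in> topspace M \<Longrightarrow>
    \<exists>W h. openin M W \<and> p \<in> W \<and> h \<in> smooth_in_charts A \<and> (\<forall>q\<in>W. f q = h q)"
  shows "f \<in> smooth_in_charts A"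
proof (rule smooth_in_charts_locallyI)
  fix p assume p: "p \<in> topspace M"
  then obtain U c where U: "(U, c) \<in> A" "p \<in> U" by (rule chart_ex)
  from assms[OF p] obtain W h where W: "openin M W" "p \<in> W" "h \<in> smooth_in_charts A"
    "\<And>q. q \<in> W \<Longrightarrow> f q = h q" by blast
  have "smooth_on (c ` U) (h \<circ> inv_into U c)" using W(3) U(1) by (auto simp: smooth_in_charts_def)
  then have "smooth_on (c ` (U \<inter> W)) (h \<circ> inv_into U c)"
    by (rule smooth_on_subset) auto
  then show "\<exists>W U c F. openin M W \<and> p \<in> W \<and> (U, c) \<in> A \<and> W \<subseteq> U \<and>
    smooth_on (c ` W) F \<and> (\<forall>q\<in>W. f q = F (c q))"
    using U W chart_openin[OF U(1)] chart_inv[OF U(1)]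
    by (intro exI[of _ "U \<inter> W"] exI[of _ U] exI[of _ c] exI[of _ "h \<circ> inv_into U c"]) auto
qed

text \<open>\<open>W\<close> and the complement of \<open>K\<close> form an open cover; on the first
  \<open>f\<close> has the expression \<open>F\<close>, on the second it is 0.\<close>

lemma extension_by_zero_smooth:
  assumes U: "(U, c) \<in> A" and W: "openin M W" "W \<subseteq> U" and K: "closedin M K" "K \<subseteq> W"
    and F: "smooth_on (c ` W) F" "\<And>q. q \<in> W \<Longrightarrow> f q = F (c q)" and zero: "\<And>q. q \<notin> K \<Longrightarrow> f q = 0"
  shows "f \<in> C"
proof -
  have "f \<in> smooth_in_charts A"
  proof (rule smooth_in_charts_locallyI)
    fix p assume p: "p \<in> topspace M"
    show "\<exists>W U c F. openin M W \<and> p \<in> W \<and> (U, c) \<in> A \<and> W \<subseteq> U \<and>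
      smooth_on (c ` W) F \<and> (\<forall>q\<in>W. f q = F (c q))"
    proof (cases "p \<in> W")
      case True
      then show ?thesis using U W F by blast
    next
      case False
      obtain V d where V: "(V, d) \<in> A" "p \<in> V" using p by (rule chart_ex)
      define O' where "O' = V \<inter> (topspace M - K)"
      have O': "openin M O'" "O' \<subseteq> V" "p \<in> O'"
        using V False K p chart_openin[OF V(1)] by (auto simp: O'_def)
      have "d ` O' = d ` (V \<inter> O')" using O'(2) by auto
      then have "smooth_on (d ` O') (\<lambda>_. 0::real)"
        using chart_open_map[OF V(1) O'(1)] by (simp add: smooth_on_def Ck_on_const)
      moreover have "\<forall>q\<in>O'. f q = 0" using zero by (auto simp: O'_def)
      ultimately show ?thesis using O' V(1) by blast
    qed
  qed
  moreover have "f p = 0" if "p \<notin> topspace M" for p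
    using that K(1) zero closedin_subset by blast
  ultimately show ?thesis by (simp add: smooth_functions_iff)
qed

lemmas chart_extension_smooth = extension_by_zero_smooth[OF _ chart_openin order_refl]

text \<open>The Euclidean cutoff carried over by the chart. The open \<open>N\<close> is where
  multiplying by \<open>\<beta>\<close> changes nothing; the closed \<open>K\<close> allows products
  with functions known only on \<open>W\<close> to be extended by zero.\<close>

lemma bump_exists:
  assumes "(U, c) \<in> A" "p \<in> U" "openin M W" "p \<in> W"
  obtains \<beta> N K where "\<beta> \<in> C" "openin M N" "p \<in> N" "N \<subseteq> K" "closedin M K" "K \<subseteq> U" "K \<subseteq> W"
    "\<And>q. q \<in> N \<Longrightarrow> \<beta> q = 1" "\<And>q. q \<notin> K \<Longrightarrow> \<beta> q = 0"
proof -
  have "open (c ` (U \<inter> W))" "c p \<in> c ` (U \<inter> W)"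
    using chart_open_map[OF assms(1,3)] assms(2,4) by auto
  then obtain r where r: "r > 0" "cball (c p) r \<subseteq> c ` (U \<inter> W)"
    by (meson open_contains_cball)
  obtain \<psi> :: "'e \<Rightarrow> real" where \<psi>: "smooth_on UNIV \<psi>"
    "\<And>x. x \<in> ball (c p) (r / 2) \<Longrightarrow> \<psi> x = 1" "\<And>x. x \<notin> cball (c p) r \<Longrightarrow> \<psi> x = 0"
    by (rule smooth_cutoff_exists[OF r(1), of "c p"]) blast
  define K where "K = {q \<in> U. c q \<in> cball (c p) r}"
  define N where "N = {q \<in> U. c q \<in> ball (c p) (r / 2)}"
  define \<beta> where "\<beta> q = (if q \<in> U then \<psi> (c q) else 0)" for q
  have K: "closedin M K"
    unfolding K_def by (rule chart_vimage_closedin[OF assms(1)]) (use r(2) in auto)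
  have \<beta>0: "\<beta> q = 0" if "q \<notin> K" for q using that \<psi>(3) by (auto simp: \<beta>_def K_def)
  show ?thesis
  proof
    show "\<beta> \<in> C"
    proof (rule chart_extension_smooth[OF assms(1) assms(1) K])
      show "smooth_on (c ` U) \<psi>"
        by (rule smooth_on_subset[OF \<psi>(1)]) simp
    qed (auto simp: \<beta>_def K_def \<psi>(3))
    show "openin M N" unfolding N_def by (rule chart_vimage_openin[OF assms(1)]) simp
    show "p \<in> N" using assms(2) r(1) by (simp add: N_def)
    show "N \<subseteq> K" using r(1) by (auto simp: N_def K_def)
    show "K \<subseteq> U" by (auto simp: K_def)
    show "K \<subseteq> W"
    proof
      fix q assume "q \<in> K"
      then have q: "q \<in> U" "c q \<in> c ` (U \<inter> W)" using r(2) by (auto simp: K_def)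
      then obtain s where "s \<in> U" "s \<in> W" "c q = c s" by blast
      then show "q \<in> W"
        using inj_onD[OF chart_inj[OF assms(1)], of q s] q(1) by simp
    qed
    show "\<beta> q = 1" if "q \<in> N" for q using that \<psi>(2) by (auto simp: N_def \<beta>_def)
  qed (use K \<beta>0 in auto)
qed

section \<open>Ring operations on smooth functions, and local reciprocals\<close>

lemma smooth_in_charts_chart: "(U, c) \<in> A \<Longrightarrow> f \<in> smooth_in_charts A \<Longrightarrow> smooth_on (c ` U) (f \<circ> inv_into U c)"
  by (auto simp: smooth_in_charts_def)

lemma smooth_in_charts_iff:
  "f \<in> smooth_in_charts A \<longleftrightarrow> (\<forall>U c k. (U, c) \<in> A \<longrightarrow> Ck_on k (c ` U) (\<lambda>x. f (inv_into U c x)))"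
  by (auto simp: smooth_in_charts_def smooth_on_def o_def)

lemma smooth_in_charts_const: "(\<lambda>_. a) \<in> smooth_in_charts A"
  by (simp add: smooth_in_charts_iff Ck_on_const chart_open_image)

lemma smooth_in_charts_add:
  "f \<in> smooth_in_charts A \<Longrightarrow> h \<in> smooth_in_charts A \<Longrightarrow> f + h \<in> smooth_in_charts A"
  by (simp add: smooth_in_charts_iff Ck_on_add chart_open_image)

lemma smooth_in_charts_mult:
  "f \<in> smooth_in_charts A \<Longrightarrow> h \<in> smooth_in_charts A \<Longrightarrow> f * h \<in> smooth_in_charts A"
  by (simp add: smooth_in_charts_iff Ck_on_mult chart_open_image)

lemma C_add: "f \<in> C \<Longrightarrow> h \<in> C \<Longrightarrow> f + h \<in> C"
  by (simp add: smooth_functions_iff smooth_in_charts_add)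

lemma C_mult: "f \<in> C \<Longrightarrow> h \<in> smooth_in_charts A \<Longrightarrow> f * h \<in> C"
  by (simp add: smooth_functions_iff smooth_in_charts_mult)

lemma C_smooth_in_charts: "f \<in> C \<Longrightarrow> f \<in> smooth_in_charts A"
  by (simp add: smooth_functions_iff)

lemma C_scale: "f \<in> C \<Longrightarrow> (\<lambda>_. a) * f \<in> C"
  by (simp add: mult.commute[of "\<lambda>_. a"] C_mult smooth_in_charts_const)

lemma C_zero: "0 \<in> C"
  using smooth_in_charts_const[of 0] by (simp add: smooth_functions_iff zero_fun_def)

lemma C_sum: "(\<And>i. i \<in> I \<Longrightarrow> f i \<in> C) \<Longrightarrow> sum f I \<in> C"
  by (induction I rule: infinite_finite_induct) (auto intro: C_add C_zero)

text \<open>The unit of the ring \<open>C\<close>. A real constant belongs to \<open>C\<close>, in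
  general, only after multiplication by it.\<close>

definition unit_fun :: "'a sfun" where
  "unit_fun = (\<lambda>p. if p \<in> topspace M then 1 else 0)"

lemma unit_fun_C: "unit_fun \<in> C"
proof -
  have "unit_fun \<in> smooth_in_charts A"
  proof (rule smooth_in_charts_local)
    fix p assume "p \<in> topspace M"
    then show "\<exists>W h. openin M W \<and> p \<in> W \<and> h \<in> smooth_in_charts A \<and> (\<forall>q\<in>W. unit_fun q = h q)"
      using smooth_in_charts_const[of 1]
      by (intro exI[of _ "topspace M"] exI[of _ "\<lambda>_. 1"]) (auto simp: unit_fun_def)
  qed
  then show ?thesis by (simp add: smooth_functions_iff unit_fun_def)
qed

lemma unit_fun_mult: "f \<in> C \<Longrightarrow> unit_fun * f = f"
  by (auto simp: unit_fun_def smooth_functions_iff)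

text \<open>The reciprocal of \<open>d\<close> is smooth where \<open>d\<close> has no zero; a bump
  with support in that open set makes it global without changing it near \<open>p\<close>.\<close>

lemma smooth_inverse_near:
  assumes "d \<in> smooth_in_charts A" "p \<in> topspace M" "d p \<noteq> 0"
  obtains h N where "h \<in> C" "openin M N" "p \<in> N" "\<And>q. q \<in> N \<Longrightarrow> h q * d q = 1"
proof -
  obtain U c where U: "(U, c) \<in> A" "p \<in> U" using assms(2) by (rule chart_ex)
  define D where "D = d \<circ> inv_into U c"
  have D: "smooth_on (c ` U) D" unfolding D_def by (rule smooth_in_charts_chart[OF U(1) assms(1)])
  have D_c: "D (c q) = d q" if "q \<in> U" for q using that by (simp add: D_def chart_inv[OF U(1)])
  define T where "T = {x \<in> c ` U. D x \<in> - {0}}"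
  have "continuous_on (c ` U) D" using D by (auto simp: smooth_on_def intro: Ck_on_continuous)
  then have T: "open T"
    using continuous_open_preimage[of "c ` U" D "- {0}"] chart_open_image[OF U(1)]
    by (simp add: T_def Int_def vimage_def open_Compl)
  define W where "W = {q \<in> U. c q \<in> T}"
  have W: "openin M W" unfolding W_def by (rule chart_vimage_openin[OF U(1) T])
  have pW: "p \<in> W" using U(2) assms(3) D_c by (auto simp: W_def T_def)
  obtain \<beta> N K where \<beta>: "\<beta> \<in> C" "openin M N" "p \<in> N" "N \<subseteq> K"
    "closedin M K" "K \<subseteq> U" "K \<subseteq> W" "\<And>q. q \<in> N \<Longrightarrow> \<beta> q = 1" "\<And>q. q \<notin> K \<Longrightarrow> \<beta> q = 0"
    by (rule bump_exists[OF U W pW]) blast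
  define h where "h q = \<beta> q * inverse (d q)" for q
  have "h \<in> C"
  proof (rule extension_by_zero_smooth[OF U(1) W _ \<beta>(5,7), where F="\<lambda>x. (\<beta> \<circ> inv_into U c) x * inverse (D x)"])
    have "c ` W = c ` (U \<inter> W)" by (auto simp: W_def)
    then have cW: "open (c ` W)" using chart_open_map[OF U(1) W] by simp
    have sub: "c ` W \<subseteq> c ` U" "\<And>x. x \<in> c ` W \<Longrightarrow> D x \<noteq> 0" by (auto simp: W_def T_def)
    show "smooth_on (c ` W) (\<lambda>x. (\<beta> \<circ> inv_into U c) x * inverse (D x))"
      by (intro smooth_on_mult[OF cW] smooth_on_inverse[OF cW] sub(2) smooth_on_subset[OF _ sub(1)] D
          smooth_in_charts_chart[OF U(1) C_smooth_in_charts[OF \<beta>(1)]])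
    show "h q = (\<beta> \<circ> inv_into U c) (c q) * inverse (D (c q))" if "q \<in> W" for q
      using that by (auto simp: W_def h_def D_c chart_inv[OF U(1)])
  qed (auto simp: W_def h_def \<beta>(9))
  moreover have "h q * d q = 1" if "q \<in> N" for q
    using that \<beta>(4,7,8) D_c[of q] by (auto simp: h_def W_def T_def)
  ultimately show ?thesis using that \<beta>(2,3) by blast
qed

end

section \<open>Vector fields as derivations\<close>

lemma sum_fun_apply: "(\<Sum>i\<in>I. f i) p = (\<Sum>i\<in>I. f i p)"
  for f :: "'i \<Rightarrow> 'b \<Rightarrow> 'c::comm_monoid_add"
  by (induction I rule: infinite_finite_induct) auto

context manifold
begin

section \<open>Module structure and locality of derivations\<close>

lemma vfield:
  assumes "X \<in> \<X>"
  shows vfield_outside: "f \<notin> C \<Longrightarrow> X f = 0"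
    and vfield_C: "f \<in> C \<Longrightarrow> X f \<in> C"
    and vfield_plus: "f \<in> C \<Longrightarrow> h \<in> C \<Longrightarrow> X (f + h) = X f + X h"
    and vfield_scale: "f \<in> C \<Longrightarrow> X ((\<lambda>_. a) * f) = (\<lambda>_. a) * X f"
    and vfield_mult: "f \<in> C \<Longrightarrow> h \<in> C \<Longrightarrow> X (f * h) = X f * h + f * X h"
  using assms by (auto simp: vector_fields_def)

lemma vfieldI:
  assumes "\<And>f. f \<notin> C \<Longrightarrow> X f = 0" "\<And>f. f \<in> C \<Longrightarrow> X f \<in> C"
    and "\<And>f h. f \<in> C \<Longrightarrow> h \<in> C \<Longrightarrow> X (f + h) = X f + X h"
    and "\<And>f a. f \<in> C \<Longrightarrow> X ((\<lambda>_. a) * f) = (\<lambda>_. a) * X f"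
    and "\<And>f h. f \<in> C \<Longrightarrow> h \<in> C \<Longrightarrow> X (f * h) = X f * h + f * X h"
  shows "X \<in> \<X>"
  using assms by (auto simp: vector_fields_def)

lemma vfield_add:
  assumes "X \<in> \<X>" "Y \<in> \<X>"
  shows "X + Y \<in> \<X>"
proof (rule vfieldI)
  show "(X + Y) f = 0" if "f \<notin> C" for f
    by (simp only: plus_fun_apply vfield_outside[OF _ that] assms add_0_left)
  fix f assume f: "f \<in> C"
  show "(X + Y) f \<in> C" using f by (simp add: C_add vfield_C assms)
  show "(X + Y) ((\<lambda>_. a) * f) = (\<lambda>_. a) * (X + Y) f" for a
    by (simp only: plus_fun_apply vfield_scale[OF _ f] assms distrib_left)
  fix h assume h: "h \<in> C"
  show "(X + Y) (f + h) = (X + Y) f + (X + Y) h"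
    by (rule ext) (simp add: vfield_plus[OF assms(1) f h] vfield_plus[OF assms(2) f h])
  show "(X + Y) (f * h) = (X + Y) f * h + f * (X + Y) h"
    by (rule ext) (simp add: vfield_mult[OF assms(1) f h] vfield_mult[OF assms(2) f h] algebra_simps)
qed

text \<open>Assuming that multiplication by \<open>f\<close> preserves \<open>C\<close>, rather than
  \<open>f \<in> C\<close>, covers the real constants as well.\<close>

lemma vfield_fmult_closed:
  assumes "X \<in> \<X>" "\<And>h. h \<in> C \<Longrightarrow> f * h \<in> C"
  shows "f \<cdot>\<^sub>F X \<in> \<X>"
proof (rule vfieldI)
  show "(f \<cdot>\<^sub>F X) h = 0" if "h \<notin> C" for h
    by (simp only: fmult_def vfield_outside[OF assms(1) that] mult_zero_right)
  fix h assume h: "h \<in> C"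
  show "(f \<cdot>\<^sub>F X) h \<in> C" unfolding fmult_def by (rule assms(2)[OF vfield_C[OF assms(1) h]])
  show "(f \<cdot>\<^sub>F X) ((\<lambda>_. a) * h) = (\<lambda>_. a) * (f \<cdot>\<^sub>F X) h" for a
    by (rule ext) (simp add: fmult_def vfield_scale[OF assms(1) h])
  fix k assume k: "k \<in> C"
  show "(f \<cdot>\<^sub>F X) (h + k) = (f \<cdot>\<^sub>F X) h + (f \<cdot>\<^sub>F X) k"
    by (rule ext) (simp add: fmult_def vfield_plus[OF assms(1) h k] algebra_simps)
  show "(f \<cdot>\<^sub>F X) (h * k) = (f \<cdot>\<^sub>F X) h * k + h * (f \<cdot>\<^sub>F X) k"
    by (rule ext) (simp add: fmult_def vfield_mult[OF assms(1) h k] algebra_simps)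
qed

lemma vfield_fmult: "f \<in> C \<Longrightarrow> X \<in> \<X> \<Longrightarrow> f \<cdot>\<^sub>F X \<in> \<X>"
  by (rule vfield_fmult_closed) (auto intro: C_mult C_smooth_in_charts)

lemma vfield_scale_closed: "X \<in> \<X> \<Longrightarrow> (\<lambda>_. a) \<cdot>\<^sub>F X \<in> \<X>"
  by (rule vfield_fmult_closed) (auto intro: C_scale)

lemma vfield_zero: "0 \<in> \<X>"
  by (rule vfieldI) (simp_all add: C_zero)

lemma vfield_sum: "(\<And>i. i \<in> I \<Longrightarrow> X i \<in> \<X>) \<Longrightarrow> sum X I \<in> \<X>"
  by (induction I rule: infinite_finite_induct) (auto intro: vfield_add vfield_zero)

lemma vfield_apply_zero: "X \<in> \<X> \<Longrightarrow> X 0 = 0"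
  using vfield_plus[of X 0 0] C_zero by simp

lemma vfield_apply_sum:
  assumes "X \<in> \<X>" "\<And>i. i \<in> I \<Longrightarrow> f i \<in> C"
  shows "X (sum f I) = (\<Sum>i\<in>I. X (f i))"
  using assms(2)
proof (induction I rule: infinite_finite_induct)
  case (insert i I)
  have "f i \<in> C" "sum f I \<in> C" using insert.prems by (auto intro: C_sum)
  moreover have "X (sum f I) = (\<Sum>i\<in>I. X (f i))" by (rule insert.IH) (simp add: insert.prems)
  ultimately show ?case by (simp only: sum.insert[OF insert.hyps] vfield_plus[OF assms(1)])
qed (simp_all only: sum.infinite sum.empty vfield_apply_zero[OF assms(1)] not_False_eq_True)

text \<open>The Leibniz rule for the idempotent \<open>unit_fun\<close> reads
  \<open>X unit_fun = 2 * X unit_fun\<close>.\<close>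

lemma vfield_apply_const:
  assumes "X \<in> \<X>"
  shows "X ((\<lambda>_. a) * unit_fun) = 0"
proof -
  have "X (unit_fun * unit_fun) = X unit_fun + X unit_fun"
    using vfield_mult[OF assms unit_fun_C unit_fun_C] unit_fun_mult[OF vfield_C[OF assms unit_fun_C]]
    by (simp add: mult.commute)
  then have "X unit_fun = 0" by (simp add: unit_fun_mult[OF unit_fun_C])
  then show ?thesis by (simp add: vfield_scale[OF assms unit_fun_C])
qed

lemma bump_at:
  assumes "openin M W" "p \<in> W"
  obtains \<beta> where "\<beta> \<in> C" "\<beta> p = 1" "\<And>q. q \<notin> W \<Longrightarrow> \<beta> q = 0"
proof -
  have "p \<in> topspace M" using assms openin_subset by blast
  then obtain U c where U: "(U, c) \<in> A" "p \<in> U" by (rule chart_ex)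
  obtain \<beta> N K where "\<beta> \<in> C" "openin M N" "p \<in> N" "N \<subseteq> K" "closedin M K" "K \<subseteq> U" "K \<subseteq> W"
    "\<And>q. q \<in> N \<Longrightarrow> \<beta> q = 1" "\<And>q. q \<notin> K \<Longrightarrow> \<beta> q = 0"
    by (rule bump_exists[OF U assms]) blast
  then show ?thesis by (intro that[of \<beta>]) blast+
qed

text \<open>For a bump \<open>\<beta>\<close> vanishing off \<open>W\<close>,
  \<open>\<beta> * f = \<beta> * h\<close> holds everywhere. In the Leibniz rule at \<open>p\<close>
  the terms with \<open>X \<beta>\<close> cancel, as \<open>f\<close> and \<open>h\<close> agree
  there, and \<open>\<beta> p = 1\<close> leaves the claim.\<close>

lemma vfield_local:
  assumes "X \<in> \<X>" "f \<in> C" "h \<in> C" "openin M W" "p \<in> W" "\<And>q. q \<in> W \<Longrightarrow> f q = h q"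
  shows "X f p = X h p"
proof -
  obtain \<beta> where \<beta>: "\<beta> \<in> C" "\<beta> p = 1" "\<And>q. q \<notin> W \<Longrightarrow> \<beta> q = 0"
    by (rule bump_at[OF assms(4,5)]) blast
  have "\<beta> * f = \<beta> * h"
  proof
    show "(\<beta> * f) q = (\<beta> * h) q" for q using \<beta>(3)[of q] assms(6)[of q] by (cases "q \<in> W") auto
  qed
  then have "X (\<beta> * f) p = X (\<beta> * h) p" by simp
  then show ?thesis
    using assms(5,6) \<beta>(2) by (simp add: vfield_mult[OF assms(1) \<beta>(1)] assms(2,3))
qed

text \<open>What a 1-form and a bilinear form with one slot fixed have in common; locality and frame
  expansion are proved once for both.\<close>

definition module_map :: "('a vfield \<Rightarrow> 'a sfun) \<Rightarrow> bool" where
  "module_map T \<longleftrightarrow> (\<forall>X\<in>\<X>. \<forall>Y\<in>\<X>. T (X + Y) = T X + T Y) \<and> (\<forall>f\<in>C. \<forall>X\<in>\<X>. T (f \<cdot>\<^sub>F X) = f * T X)"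

text \<open>For a bump vanishing off \<open>W\<close> the fields \<open>\<beta> X\<close> and
  \<open>\<beta> Y\<close> are equal globally, and \<open>T\<close> lets the factor
  \<open>\<beta>\<close> out, whose value at \<open>p\<close> is 1.\<close>

lemma module_map_local:
  assumes "module_map T" "X \<in> \<X>" "Y \<in> \<X>" "openin M W" "p \<in> W"
    and eq: "\<And>f q. f \<in> C \<Longrightarrow> q \<in> W \<Longrightarrow> X f q = Y f q"
  shows "T X p = T Y p"
proof -
  obtain \<beta> where \<beta>: "\<beta> \<in> C" "\<beta> p = 1" "\<And>q. q \<notin> W \<Longrightarrow> \<beta> q = 0"
    by (rule bump_at[OF assms(4,5)]) blast
  have "\<beta> \<cdot>\<^sub>F X = \<beta> \<cdot>\<^sub>F Y"
  proof (intro ext)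
    show "(\<beta> \<cdot>\<^sub>F X) f q = (\<beta> \<cdot>\<^sub>F Y) f q" for f q
    proof (cases "f \<in> C")
      case True
      then show ?thesis using \<beta>(3)[of q] eq[of f q] by (cases "q \<in> W") (auto simp: fmult_def)
    qed (simp add: fmult_def vfield_outside assms(2,3))
  qed
  moreover have "T (\<beta> \<cdot>\<^sub>F X) = \<beta> * T X" "T (\<beta> \<cdot>\<^sub>F Y) = \<beta> * T Y"
    using assms(1-3) \<beta>(1) unfolding module_map_def by blast+
  ultimately have "(\<beta> * T X) p = (\<beta> * T Y) p" by simp
  then show ?thesis using \<beta>(2) by simp
qed

lemma module_map_sum:
  assumes "module_map T" "\<And>i. i \<in> I \<Longrightarrow> f i \<in> C" "\<And>i. i \<in> I \<Longrightarrow> X i \<in> \<X>"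
  shows "T (\<Sum>i\<in>I. f i \<cdot>\<^sub>F X i) = (\<Sum>i\<in>I. f i * T (X i))"
proof -
  have "T (0 \<cdot>\<^sub>F 0) = 0 * T 0"
    using assms(1) C_zero vfield_zero unfolding module_map_def by blast
  moreover have "(0 :: 'a sfun) \<cdot>\<^sub>F (0 :: 'a vfield) = 0" by (simp add: fmult_def fun_eq_iff)
  ultimately have 0: "T 0 = 0" by simp
  show ?thesis
    using assms(2,3)
  proof (induction I rule: infinite_finite_induct)
    case (insert i I)
    have "T (f i \<cdot>\<^sub>F X i + (\<Sum>i\<in>I. f i \<cdot>\<^sub>F X i)) = T (f i \<cdot>\<^sub>F X i) + T (\<Sum>i\<in>I. f i \<cdot>\<^sub>F X i)"
    proof -
      have "f i \<cdot>\<^sub>F X i \<in> \<X>" by (intro vfield_fmult insert.prems) simp_all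
      moreover have "(\<Sum>i\<in>I. f i \<cdot>\<^sub>F X i) \<in> \<X>" by (intro vfield_sum vfield_fmult insert.prems) simp_all
      ultimately show ?thesis using assms(1) unfolding module_map_def by blast
    qed
    moreover have "T (f i \<cdot>\<^sub>F X i) = f i * T (X i)"
      using assms(1) insert.prems unfolding module_map_def by blast
    moreover have "T (\<Sum>i\<in>I. f i \<cdot>\<^sub>F X i) = (\<Sum>i\<in>I. f i * T (X i))"
      by (rule insert.IH) (use insert.prems in auto)
    ultimately show ?case by (simp only: sum.insert[OF insert.hyps])
  qed (simp_all add: 0)
qed

subsection \<open>Local frames\<close>

text \<open>The derivative along \<open>b\<close> in the chart, damped by \<open>\<beta>\<close> so
  that \<open>E f\<close> extends by zero to a smooth function. The derivation laws are the
  differentiation rules in the chart.\<close>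

lemma coordinate_field:
  assumes U: "(U, c) \<in> A" and \<beta>: "\<beta> \<in> C" "\<And>q. q \<notin> K \<Longrightarrow> \<beta> q = 0" and K: "closedin M K" "K \<subseteq> U"
  shows "\<exists>E\<in>\<X>. \<forall>f\<in>C. \<forall>q\<in>U. E f q = \<beta> q * frechet_derivative (f \<circ> inv_into U c) (at (c q)) b"
proof -
  define D where "D f x = frechet_derivative (f \<circ> inv_into U c) (at x) b" for f :: "'a sfun" and x
  define E where "E f = (if f \<in> C then (\<lambda>q. if q \<in> U then \<beta> q * D f (c q) else 0) else 0)" for f
  have smooth: "smooth_on (c ` U) (f \<circ> inv_into U c)" if "f \<in> C" for f
    using smooth_in_charts_chart[OF U C_smooth_in_charts[OF that]] .
  have der: "(f \<circ> inv_into U c has_derivative frechet_derivative (f \<circ> inv_into U c) (at (c q))) (at (c q))"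
    if "f \<in> C" "q \<in> U" for f q
    using smooth_on_has_derivative[OF smooth[OF that(1)]] that(2) by blast
  have D_eq: "D f (c q) = f' b" if "(f \<circ> inv_into U c has_derivative f') (at (c q))" for f f' q
    unfolding D_def using frechet_derivative_at[OF that] by simp
  have E_apply: "E f q = (if q \<in> U then \<beta> q * D f (c q) else 0)" if "f \<in> C" for f q
    using that by (simp add: E_def)
  have "E \<in> \<X>"
  proof (rule vfieldI)
    fix f assume f: "f \<in> C"
    show "E f \<in> C"
    proof (rule chart_extension_smooth[OF U U K, where F="\<lambda>x. (\<beta> \<circ> inv_into U c) x * D f x"])
      show "smooth_on (c ` U) (\<lambda>x. (\<beta> \<circ> inv_into U c) x * D f x)"
        unfolding D_def
        by (intro smooth_on_mult chart_open_image[OF U] smooth[OF \<beta>(1)] smooth_on_derivative smooth[OF f])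
    qed (use \<beta>(2) chart_inv[OF U] in \<open>auto simp: E_apply[OF f]\<close>)
    show "E ((\<lambda>_. a) * f) = (\<lambda>_. a) * E f" for a
    proof
      fix q
      have "D ((\<lambda>_. a) * f) (c q) = a * D f (c q)" if "q \<in> U"
      proof (rule D_eq[THEN trans])
        have "((\<lambda>x. a * (f \<circ> inv_into U c) x) has_derivative
            (\<lambda>v. a * frechet_derivative (f \<circ> inv_into U c) (at (c q)) v)) (at (c q))"
          by (rule has_derivative_mult_right[OF der[OF f that]])
        then show "(((\<lambda>_. a) * f) \<circ> inv_into U c has_derivative
            (\<lambda>v. a * frechet_derivative (f \<circ> inv_into U c) (at (c q)) v)) (at (c q))"
          by (simp add: o_def)
      qed (simp add: D_def)
      then show "E ((\<lambda>_. a) * f) q = ((\<lambda>_. a) * E f) q"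
        by (simp add: E_apply f C_scale)
    qed
    fix h assume h: "h \<in> C"
    show "E (f + h) = E f + E h"
    proof
      fix q
      have "D (f + h) (c q) = D f (c q) + D h (c q)" if "q \<in> U"
      proof (rule D_eq[THEN trans])
        show "((f + h) \<circ> inv_into U c has_derivative
            (\<lambda>v. frechet_derivative (f \<circ> inv_into U c) (at (c q)) v +
                 frechet_derivative (h \<circ> inv_into U c) (at (c q)) v)) (at (c q))"
          using has_derivative_add[OF der[OF f that] der[OF h that]] by (simp add: o_def)
      qed (simp add: D_def)
      then show "E (f + h) q = (E f + E h) q"
        by (simp add: E_apply f h C_add algebra_simps)
    qed
    show "E (f * h) = E f * h + f * E h"
    proof
      fix q
      have "D (f * h) (c q) = f q * D h (c q) + D f (c q) * h q" if "q \<in> U"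
      proof (rule D_eq[THEN trans])
        show "((f * h) \<circ> inv_into U c has_derivative
            (\<lambda>v. (f \<circ> inv_into U c) (c q) * frechet_derivative (h \<circ> inv_into U c) (at (c q)) v +
                 frechet_derivative (f \<circ> inv_into U c) (at (c q)) v * (h \<circ> inv_into U c) (c q))) (at (c q))"
          using has_derivative_mult[OF der[OF f that] der[OF h that]] by (simp add: o_def)
      qed (simp add: D_def chart_inv[OF U that])
      then show "E (f * h) q = (E f * h + f * E h) q"
        by (simp add: E_apply f h C_mult C_smooth_in_charts algebra_simps)
    qed
  qed (simp add: E_def)
  then show ?thesis by (intro bexI[of _ E] ballI) (simp_all add: E_apply D_def)
qed

text \<open>\<open>x b\<close> and \<open>E b\<close> are coordinates and coordinate fields cut off
  by one bump, hence unaltered on \<open>N\<close>. For the expansion at \<open>q\<close>,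
  Hadamard's lemma centred at \<open>q\<close> writes \<open>f\<close> near \<open>q\<close> as
  \<open>f(q)\<close> plus a sum of products \<open>(x_b - x_b(q)) h_b\<close>. \<open>Y\<close>
  kills the constant, and since the first factors vanish at \<open>q\<close>, the Leibniz rule
  leaves \<open>Y(x_b)(q) h_b(q)\<close>, where \<open>h_b(q)\<close> is a partial derivative of
  \<open>f\<close>.\<close>

lemma local_frame:
  assumes "p \<in> topspace M"
  obtains N E x where "openin M N" "p \<in> N" "\<And>b::'e. E b \<in> \<X>" "\<And>b::'e. x b \<in> C"
    "\<And>Y f q. Y \<in> \<X> \<Longrightarrow> f \<in> C \<Longrightarrow> q \<in> N \<Longrightarrow> Y f q = (\<Sum>b\<in>Basis. Y (x b) q * E b f q)"
    "\<And>b b' q. b \<in> Basis \<Longrightarrow> b' \<in> Basis \<Longrightarrow> q \<in> N \<Longrightarrow> E b (x b') q = (if b = b' then 1 else 0)"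
proof -
  obtain U c where U: "(U, c) \<in> A" "p \<in> U" using assms by (rule chart_ex)
  obtain \<beta> N K where \<beta>: "\<beta> \<in> C" and N: "openin M N" "p \<in> N" "N \<subseteq> K" and K: "closedin M K" "K \<subseteq> U"
    and \<beta>1: "\<And>q. q \<in> N \<Longrightarrow> \<beta> q = 1" and \<beta>0: "\<And>q. q \<notin> K \<Longrightarrow> \<beta> q = 0"
    by (rule bump_exists[OF U chart_openin[OF U(1)] U(2)]) blast
  have NU: "N \<subseteq> U" using N(3) K(2) by blast
  have cN: "open (c ` N)"
    using chart_open_map[OF U(1) N(1)] NU by (simp add: Int_absorb1)
  obtain E where E: "\<And>b. E b \<in> \<X>" and E_apply: "\<And>b f q. f \<in> C \<Longrightarrow> q \<in> U \<Longrightarrow>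
      E b f q = \<beta> q * frechet_derivative (f \<circ> inv_into U c) (at (c q)) b"
    using coordinate_field[OF U(1) \<beta> \<beta>0 K] by metis
  define x where "x b q = (if q \<in> U then \<beta> q * (c q \<bullet> b) else 0)" for b q
  have x: "x b \<in> C" for b
  proof (rule chart_extension_smooth[OF U(1) U(1) K, where F="\<lambda>y. (\<beta> \<circ> inv_into U c) y * (y \<bullet> b)"])
    show "smooth_on (c ` U) (\<lambda>y. (\<beta> \<circ> inv_into U c) y * (y \<bullet> b))"
    proof (rule smooth_on_mult[OF chart_open_image[OF U(1)]])
      show "smooth_on (c ` U) (\<lambda>y. y \<bullet> b)"
        unfolding smooth_on_def
        by (intro allI Ck_on_bounded_linear[OF _ bounded_linear_inner_left] Ck_on_id chart_open_image[OF U(1)])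
    qed (rule smooth_in_charts_chart[OF U(1) C_smooth_in_charts[OF \<beta>]])
  qed (use \<beta>0 chart_inv[OF U(1)] in \<open>auto simp: x_def\<close>)
  have x_N: "x b q = c q \<bullet> b" if "q \<in> N" for b q using that NU \<beta>1 by (auto simp: x_def)
  show ?thesis
  proof
    fix b b' :: 'e and q assume b: "b \<in> Basis" "b' \<in> Basis" and q: "q \<in> N"
    have "((\<lambda>y. y \<bullet> b') has_derivative (\<lambda>y. y \<bullet> b')) (at (c q))"
      by (rule bounded_linear_imp_has_derivative[OF bounded_linear_inner_left])
    then have "(x b' \<circ> inv_into U c has_derivative (\<lambda>y. y \<bullet> b')) (at (c q))"
      by (rule has_derivative_transform_within_open[OF _ cN])
        (use q NU chart_inv[OF U(1)] in \<open>auto simp: x_N\<close>)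
    then have "frechet_derivative (x b' \<circ> inv_into U c) (at (c q)) = (\<lambda>y. y \<bullet> b')"
      using frechet_derivative_at by metis
    then show "E b (x b') q = (if b = b' then 1 else 0)"
      using q NU b by (auto simp: E_apply[OF x] \<beta>1 inner_Basis)
  next
    fix Y f q assume Y: "Y \<in> \<X>" and f: "f \<in> C" and q: "q \<in> N"
    have qU: "q \<in> U" using q NU by auto
    have "c q \<in> c ` N" using q by simp
    then obtain r where r: "r > 0" "ball (c q) r \<subseteq> c ` N"
      using cN by (meson open_contains_ball)
    have sm: "smooth_on (ball (c q) r) (f \<circ> inv_into U c)"
      by (rule smooth_on_subset[OF smooth_in_charts_chart[OF U(1) C_smooth_in_charts[OF f]]])
        (use r(2) NU in blast)
    have cqr: "c q \<in> ball (c q) r" using r(1) by simp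
    obtain h :: "'e \<Rightarrow> 'e \<Rightarrow> real" where h: "\<And>b. smooth_on (ball (c q) r) (h b)"
      "\<And>b. h b (c q) = frechet_derivative (f \<circ> inv_into U c) (at (c q)) b"
      and h_eq: "\<And>y. y \<in> ball (c q) r \<Longrightarrow> (f \<circ> inv_into U c) y =
        (f \<circ> inv_into U c) (c q) + (\<Sum>b\<in>Basis. ((y - c q) \<bullet> b) * h b y)"
      by (rule hadamard[OF open_ball convex_ball cqr sm]) blast
    define W where "W = {q' \<in> U. c q' \<in> ball (c q) r}"
    have W: "openin M W" "q \<in> W"
      unfolding W_def using chart_vimage_openin[OF U(1) open_ball] r(1) qU by auto
    have WU: "W \<subseteq> U" by (auto simp: W_def)
    have WN: "W \<subseteq> N"
    proof
      fix s assume s: "s \<in> W"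
      then have "c s \<in> c ` N" using r(2) by (auto simp: W_def)
      then obtain t where t: "t \<in> N" "c s = c t" by blast
      with inj_onD[OF chart_inj[OF U(1)], of s t] show "s \<in> N" using s WU NU by auto
    qed
    \<comment> \<open>\<open>h b\<close> is controlled only on the ball, while \<open>Y\<close> acts
      on global functions: a second bump, supported in the preimage \<open>W\<close> of the ball,
      turns it into \<open>H b\<close>.\<close>
    obtain \<gamma> N' K' where \<gamma>: "\<gamma> \<in> C" and N': "openin M N'" "q \<in> N'" "N' \<subseteq> K'"
      and K': "closedin M K'" "K' \<subseteq> U" "K' \<subseteq> W"
      and \<gamma>1: "\<And>q. q \<in> N' \<Longrightarrow> \<gamma> q = 1" and \<gamma>0: "\<And>q. q \<notin> K' \<Longrightarrow> \<gamma> q = 0"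
      by (rule bump_exists[OF U(1) qU W]) blast
    define H where "H b s = \<gamma> s * h b (c s)" for b s
    have H: "H b \<in> C" for b
    proof (rule extension_by_zero_smooth[OF U(1) W(1) WU K'(1,3), where F="\<lambda>y. (\<gamma> \<circ> inv_into U c) y * h b y"])
      have cW: "open (c ` W)" "c ` W \<subseteq> c ` U" "c ` W \<subseteq> ball (c q) r"
        using chart_open_map[OF U(1) W(1)] WU by (auto simp: Int_absorb1 W_def)
      show "smooth_on (c ` W) (\<lambda>y. (\<gamma> \<circ> inv_into U c) y * h b y)"
        by (rule smooth_on_mult[OF cW(1) smooth_on_subset[OF _ cW(2)] smooth_on_subset[OF h(1) cW(3)]])
          (rule smooth_in_charts_chart[OF U(1) C_smooth_in_charts[OF \<gamma>]])
      show "H b s = (\<gamma> \<circ> inv_into U c) (c s) * h b (c s)" if "s \<in> W" for s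
        using that WU chart_inv[OF U(1)] by (auto simp: H_def)
    qed (simp add: H_def \<gamma>0)
    \<comment> \<open>\<open>y b\<close> is \<open>x b\<close> minus its value at \<open>q\<close>,
      and \<open>R\<close> below is the Hadamard expansion as a global function; the constants are
      truncated by \<open>unit_fun\<close> to stay in \<open>C\<close>.\<close>
    define y where "y b = x b + (\<lambda>_. - x b q) * unit_fun" for b
    have y: "y b \<in> C" for b unfolding y_def by (intro C_add x C_scale unit_fun_C)
    define R where "R = (\<lambda>_. f q) * unit_fun + (\<Sum>b\<in>Basis. y b * H b)"
    have yH: "y b * H b \<in> C" for b by (intro C_mult y C_smooth_in_charts H)
    have R: "R \<in> C" unfolding R_def by (intro C_add C_scale unit_fun_C C_sum yH)
    have "Y f q = Y R q"
    proof (rule vfield_local[OF Y f R N'(1,2)])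
      fix s assume s: "s \<in> N'"
      then have sW: "s \<in> W" using N'(3) K'(3) by blast
      then have "s \<in> topspace M" using W(1) openin_subset by blast
      then have u: "unit_fun s = 1" by (simp add: unit_fun_def)
      have "f s = f q + (\<Sum>b\<in>Basis. ((c s - c q) \<bullet> b) * h b (c s))"
        using h_eq[of "c s"] sW WU qU by (auto simp: W_def chart_inv[OF U(1)])
      also have "\<dots> = R s"
        using sW WN q \<gamma>1[OF s]
        by (auto simp: R_def sum_fun_apply y_def H_def u x_N inner_diff_left)
      finally show "f s = R s" .
    qed
    also have "\<dots> = (\<Sum>b\<in>Basis. Y (y b * H b) q)"
      unfolding R_def vfield_plus[OF Y C_scale[OF unit_fun_C] C_sum[OF yH]]
      by (simp add: vfield_apply_const[OF Y] vfield_apply_sum[OF Y yH] sum_fun_apply)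
    also have "\<dots> = (\<Sum>b\<in>Basis. Y (x b) q * E b f q)"
    proof (rule sum.cong)
      fix b :: 'e
      have "q \<in> topspace M" using W openin_subset by blast
      then have "y b q = 0" by (simp add: y_def unit_fun_def)
      moreover have "Y (y b) = Y (x b)"
        unfolding y_def vfield_plus[OF Y x C_scale[OF unit_fun_C]] by (simp add: vfield_apply_const[OF Y])
      moreover have "H b q = E b f q"
        using \<gamma>1[OF N'(2)] \<beta>1[OF q] by (simp add: H_def h(2) E_apply[OF f qU])
      ultimately show "Y (y b * H b) q = Y (x b) q * E b f q"
        by (simp add: vfield_mult[OF Y y H])
    qed simp
    finally show "Y f q = (\<Sum>b\<in>Basis. Y (x b) q * E b f q)" .
  qed (use N E x in auto)
qed

end

section \<open>The musical isomorphism\<close>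

context manifold
begin

text \<open>On \<open>N\<close> the field \<open>Y\<close> coincides with the global field
  \<open>Z\<close> built from the frame and the coefficients \<open>Y (x b)\<close>; locality and
  linearity of \<open>T\<close> do the rest.\<close>

lemma module_map_frame:
  assumes N: "openin M N" and E: "\<And>b::'e. E b \<in> \<X>" and x: "\<And>b::'e. x b \<in> C"
    and frame: "\<And>Y f q. Y \<in> \<X> \<Longrightarrow> f \<in> C \<Longrightarrow> q \<in> N \<Longrightarrow> Y f q = (\<Sum>b\<in>Basis. Y (x b) q * E b f q)"
    and T: "module_map T" and Y: "Y \<in> \<X>" and q: "q \<in> N"
  shows "T Y q = (\<Sum>b\<in>Basis. Y (x b) q * T (E b) q)"
proof -
  have Yx: "Y (x b) \<in> C" for b by (rule vfield_C[OF Y x])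
  define Z where "Z = (\<Sum>b\<in>Basis. Y (x b) \<cdot>\<^sub>F E b)"
  have Z: "Z \<in> \<X>" unfolding Z_def by (rule vfield_sum) (rule vfield_fmult[OF Yx E])
  have "T Y q = T Z q"
  proof (rule module_map_local[OF T Y Z N q])
    show "Y f r = Z f r" if "f \<in> C" "r \<in> N" for f r
      using frame[OF Y that] by (simp add: Z_def sum_fun_apply fmult_def)
  qed
  also have "T Z = (\<Sum>b\<in>Basis. Y (x b) * T (E b))"
    unfolding Z_def by (rule module_map_sum[OF T Yx E])
  finally show ?thesis by (simp add: sum_fun_apply)
qed

lemma one_form_module_map: "\<xi> \<in> one_forms M A \<Longrightarrow> module_map \<xi>"
  by (simp add: one_forms_def module_map_def)

lemma one_form_C: "\<xi> \<in> one_forms M A \<Longrightarrow> X \<in> \<X> \<Longrightarrow> \<xi> X \<in> C"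
  by (simp add: one_forms_def)

lemma bilinear_form_C: "bilinear_form M A g \<Longrightarrow> X \<in> \<X> \<Longrightarrow> Y \<in> \<X> \<Longrightarrow> g X Y \<in> C"
  by (simp add: bilinear_form_def)

lemma bilinear_form_module_map:
  assumes "bilinear_form M A g" "X \<in> \<X>"
  shows bilinear_form_module_map_right: "module_map (g X)"
    and bilinear_form_module_map_left: "module_map (\<lambda>Y. g Y X)"
  using assms by (simp_all add: bilinear_form_def module_map_def)

text \<open>Nondegeneracy at \<open>p\<close>, applied to the difference. It is formed as
  \<open>X + u Y\<close> with \<open>u \<in> C\<close> and \<open>u p = - 1\<close>, because
  \<open>g\<close> is postulated to be linear over \<open>C\<close>.\<close>

lemma nondegenerate_eqI:
  assumes g: "bilinear_form M A g" "nondegenerate M A g" and X: "X \<in> \<X>" and Y: "Y \<in> \<X>"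
    and p: "p \<in> topspace M" and eq: "\<And>Z. Z \<in> \<X> \<Longrightarrow> g X Z p = g Y Z p" and f: "f \<in> C"
  shows "X f p = Y f p"
proof -
  define u where "u = (\<lambda>_. - 1) * unit_fun"
  have u: "u \<in> C" "u p = - 1"
    unfolding u_def using C_scale[OF unit_fun_C] p by (simp_all add: unit_fun_def)
  define W where "W = X + u \<cdot>\<^sub>F Y"
  have uY: "u \<cdot>\<^sub>F Y \<in> \<X>" by (rule vfield_fmult[OF u(1) Y])
  have W: "W \<in> \<X>" unfolding W_def by (rule vfield_add[OF X uY])
  have "g W Z p = 0" if Z: "Z \<in> \<X>" for Z
  proof -
    have "g W Z = g X Z + u * g Y Z"
      using bilinear_form_module_map_left[OF g(1) Z] X Y uY u(1) by (simp add: module_map_def W_def)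
    then show ?thesis by (simp add: u(2) eq[OF Z])
  qed
  then have "W f p = 0" using g(2) p W f unfolding nondegenerate_def by blast
  then show ?thesis by (simp add: W_def fmult_def u(2))
qed

lemma riesz_local:
  assumes g: "bilinear_form M A g" "nondegenerate M A g" and \<xi>: "\<xi> \<in> one_forms M A"
    and p: "p \<in> topspace M"
  shows "\<exists>N X. openin M N \<and> p \<in> N \<and> X \<in> \<X> \<and> (\<forall>Y\<in>\<X>. \<forall>q\<in>N. g X Y q = \<xi> Y q)"
proof -
  obtain N E x where N: "openin M N" "p \<in> N" and E: "\<And>b::'e. E b \<in> \<X>" and x: "\<And>b::'e. x b \<in> C"
    and frame: "\<And>Y f q. Y \<in> \<X> \<Longrightarrow> f \<in> C \<Longrightarrow> q \<in> N \<Longrightarrow> Y f q = (\<Sum>b\<in>Basis. Y (x b) q * E b f q)"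
    and dual: "\<And>b b' q. b \<in> Basis \<Longrightarrow> b' \<in> Basis \<Longrightarrow> q \<in> N \<Longrightarrow> E b (x b') q = (if b = b' then 1 else 0)"
    by (rule local_frame[OF p]) blast
  have expand: "T Y q = (\<Sum>b\<in>Basis. Y (x b) q * T (E b) q)"
    if "module_map T" "Y \<in> \<X>" "q \<in> N" for T Y q
    by (rule module_map_frame[where E=E and x=x and N=N, OF N(1) E x _ that]) (rule frame)
  obtain e where e: "bij_betw e {0..<DIM('e)} (Basis :: 'e set)"
    using ex_bij_betw_nat_finite[OF finite_Basis] by blast
  define n where "n = DIM('e)"
  have e_Basis: "e i \<in> Basis" if "i < n" for i
    using e that by (auto simp: bij_betw_def n_def)
  have e_inj: "e i = e j \<longleftrightarrow> i = j" if "i < n" "j < n" for i j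
    using e that by (auto simp: bij_betw_def n_def inj_on_def)
  have e_surj: "\<exists>i<n. b = e i" if "b \<in> Basis" for b
    using e that by (force simp: bij_betw_def n_def)
  \<comment> \<open>Columns belong to the unknown field in the first slot, rows to the test field in
    the second; hence the order of the indices.\<close>
  let ?G = "\<lambda>i j. g (E (e j)) (E (e i))"
  have comb: "g (\<Sum>j<n. f j \<cdot>\<^sub>F E (e j)) (E (e i)) = (\<Sum>j<n. f j * ?G i j)" if "\<And>j. j < n \<Longrightarrow> f j \<in> C" for f i
    using module_map_sum[OF bilinear_form_module_map_left[OF g(1) E[of "e i"]], of "{..<n}" f "\<lambda>j. E (e j)"] that E
    by auto
  obtain d a where d: "d \<in> smooth_in_charts A" "d p \<noteq> 0" and a: "\<And>j. j < n \<Longrightarrow> a j \<in> smooth_in_charts A"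
    and solve: "\<And>i. i < n \<Longrightarrow> (\<Sum>j<n. ?G i j * a j) = d * \<xi> (E (e i))"
  proof (rule linear_system_solvable_near[where S="smooth_in_charts A" and G="?G" and n=n and p=p
        and w="\<lambda>i. \<xi> (E (e i))"])
    show "1 \<in> smooth_in_charts A" "- 1 \<in> smooth_in_charts A"
      using smooth_in_charts_const[of 1] smooth_in_charts_const[of "- 1"]
      by (simp_all add: one_fun_def fun_Compl_def)
    show "?G i j \<in> smooth_in_charts A" for i j
      by (intro C_smooth_in_charts bilinear_form_C[OF g(1)] E)
    show "\<xi> (E (e i)) \<in> smooth_in_charts A" for i
      by (intro C_smooth_in_charts one_form_C[OF \<xi>] E)
    \<comment> \<open>A kernel vector \<open>v\<close> of the matrix at \<open>p\<close> gives the
      field \<open>Z\<close> with constant coefficients in the frame. As \<open>g Z\<close> vanishes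
      at \<open>p\<close> on the frame, it vanishes there on every field, so \<open>Z\<close> is 0
      at \<open>p\<close>; applied to a coordinate function it returns \<open>v j\<close>.\<close>
    fix v j assume v: "\<And>i. i < n \<Longrightarrow> (\<Sum>j<n. ?G i j p * v j) = 0" and j: "j < n"
    define u where "u j = (\<lambda>_. v j) * unit_fun" for j
    have u: "u j \<in> C" "u j p = v j" for j
      unfolding u_def using C_scale[OF unit_fun_C] p by (simp_all add: unit_fun_def)
    define Z where "Z = (\<Sum>j<n. u j \<cdot>\<^sub>F E (e j))"
    have Z: "Z \<in> \<X>" unfolding Z_def by (rule vfield_sum) (rule vfield_fmult[OF u(1) E])
    have ZE: "g Z (E b) p = 0" if "b \<in> Basis" for b
    proof -
      obtain i where i: "i < n" "b = e i" using e_surj[OF \<open>b \<in> Basis\<close>] by blast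
      have "g Z (E b) p = (\<Sum>j<n. ?G i j p * v j)"
        unfolding Z_def i(2) comb[OF u(1)] by (simp add: sum_fun_apply u(2) mult.commute)
      then show ?thesis using v[OF i(1)] by simp
    qed
    have "g Z Y p = 0" if "Y \<in> \<X>" for Y
      using expand[OF bilinear_form_module_map_right[OF g(1) Z] that N(2)] ZE by simp
    then have "Z (x (e j)) p = 0" using g(2) p Z x unfolding nondegenerate_def by blast
    moreover have "Z (x (e j)) p = (\<Sum>i<n. v i * (if i = j then 1 else 0))"
      using j by (auto simp: Z_def sum_fun_apply fmult_def u(2) dual[OF e_Basis e_Basis N(2)] e_inj intro!: sum.cong)
    moreover have "\<dots> = (\<Sum>i<n. if i = j then v i else 0)" by (rule sum.cong) auto
    ultimately show "v j = 0" using j by simp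
  qed (auto intro: smooth_in_charts_add smooth_in_charts_mult)
  obtain h N' where h: "h \<in> C" and N': "openin M N'" "p \<in> N'" and hd: "\<And>q. q \<in> N' \<Longrightarrow> h q * d q = 1"
    by (rule smooth_inverse_near[OF d(1) p d(2)]) blast
  \<comment> \<open>\<open>a j\<close> need not vanish off the manifold; the factor \<open>h\<close>
    brings the product into \<open>C\<close>.\<close>
  have ha: "h * a j \<in> C" if "j < n" for j by (rule C_mult[OF h a[OF that]])
  define X where "X = (\<Sum>j<n. (h * a j) \<cdot>\<^sub>F E (e j))"
  have X: "X \<in> \<X>" unfolding X_def by (rule vfield_sum) (rule vfield_fmult[OF ha E], simp)
  have XE: "g X (E b) q = \<xi> (E b) q" if "b \<in> Basis" "q \<in> N'" for b q
  proof -
    obtain i where i: "i < n" "b = e i" using e_surj[OF \<open>b \<in> Basis\<close>] by blast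
    have "g X (E b) = (\<Sum>j<n. h * a j * ?G i j)"
      unfolding X_def i(2) by (rule comb) (rule ha)
    then have "g X (E b) q = h q * (\<Sum>j<n. ?G i j * a j) q"
      by (simp add: sum_fun_apply sum_distrib_left mult_ac)
    also have "\<dots> = h q * d q * \<xi> (E b) q" by (simp add: solve[OF i(1)] i(2))
    finally show ?thesis using hd[OF that(2)] by simp
  qed
  \<comment> \<open>On \<open>N\<close> both sides are determined by their values on the frame, and
    these match on \<open>N'\<close>, where \<open>d\<close> has been inverted.\<close>
  have "g X Y q = \<xi> Y q" if Y: "Y \<in> \<X>" and q: "q \<in> N \<inter> N'" for Y q
    using q expand[OF bilinear_form_module_map_right[OF g(1) X] Y, of q]
      expand[OF one_form_module_map[OF \<xi>] Y, of q] by (simp add: XE)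
  then show ?thesis using N N' X by (intro exI[of _ "N \<inter> N'"] exI[of _ X]) auto
qed

text \<open>By nondegeneracy the local solutions agree where they overlap, so they glue without a
  partition of unity.\<close>

lemma riesz:
  assumes g: "bilinear_form M A g" "nondegenerate M A g" and \<xi>: "\<xi> \<in> one_forms M A"
  obtains X where "X \<in> \<X>" "\<And>Y. Y \<in> \<X> \<Longrightarrow> g X Y = \<xi> Y"
proof -
  obtain N L where NL: "\<And>p. p \<in> topspace M \<Longrightarrow> openin M (N p) \<and> p \<in> N p \<and> L p \<in> \<X> \<and>
      (\<forall>Y\<in>\<X>. \<forall>q\<in>N p. g (L p) Y q = \<xi> Y q)"
    using riesz_local[OF g \<xi>] by metis
  have N: "openin M (N p)" "p \<in> N p" and L: "L p \<in> \<X>" if "p \<in> topspace M" for p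
    using NL[OF that] by auto
  have sol: "g (L p) Y q = \<xi> Y q" if "p \<in> topspace M" "Y \<in> \<X>" "q \<in> N p" for p Y q
    using NL[OF that(1)] that(2,3) by blast
  \<comment> \<open>At each point the solution chosen for that very point is used. The derivation
    laws are pointwise identities and pass to \<open>X\<close> at once; smoothness of
    \<open>X f\<close> and the equation for \<open>g X\<close> need agreement with a single
    \<open>L p\<close> on a neighbourhood, which is \<open>X_L\<close>.\<close>
  define X where "X f q = (if f \<in> C \<and> q \<in> topspace M then L q f q else 0)" for f q
  have X_L: "X f q = L p f q" if f: "f \<in> C" and p: "p \<in> topspace M" and q: "q \<in> N p" for f p q
  proof -
    have q': "q \<in> topspace M" using N(1)[OF p] q openin_subset by blast
    have "L q f q = L p f q"
      by (rule nondegenerate_eqI[OF g L[OF q'] L[OF p] q' _ f])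
        (simp add: sol[OF q' _ N(2)[OF q']] sol[OF p _ q])
    then show ?thesis using f q' by (simp add: X_def)
  qed
  have X: "X \<in> \<X>"
  proof (rule vfieldI)
    show "X f = 0" if "f \<notin> C" for f using that by (simp add: X_def fun_eq_iff)
    fix f assume f: "f \<in> C"
    have "X f \<in> smooth_in_charts A"
    proof (rule smooth_in_charts_local)
      fix p assume p: "p \<in> topspace M"
      show "\<exists>W h. openin M W \<and> p \<in> W \<and> h \<in> smooth_in_charts A \<and> (\<forall>q\<in>W. X f q = h q)"
        using N[OF p] C_smooth_in_charts[OF vfield_C[OF L[OF p] f]] X_L[OF f p] by blast
    qed
    then show "X f \<in> C" by (simp add: smooth_functions_iff X_def)
    show "X ((\<lambda>_. a) * f) = (\<lambda>_. a) * X f" for a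
      by (rule ext) (simp add: X_def f C_scale vfield_scale[OF L f])
    fix h assume h: "h \<in> C"
    show "X (f + h) = X f + X h"
      by (rule ext) (simp add: X_def f h C_add vfield_plus[OF L f h])
    show "X (f * h) = X f * h + f * X h"
      by (rule ext) (simp add: X_def f h C_mult C_smooth_in_charts vfield_mult[OF L f h])
  qed
  have "g X Y = \<xi> Y" if Y: "Y \<in> \<X>" for Y
  proof
    fix p
    show "g X Y p = \<xi> Y p"
    proof (cases "p \<in> topspace M")
      case True
      have "g X Y p = g (L p) Y p"
        using module_map_local[OF bilinear_form_module_map_left[OF g(1) Y] X L[OF True] N[OF True]]
          X_L[OF _ True] by blast
      then show ?thesis using sol[OF True Y N(2)[OF True]] by simp
    next
      case False
      then show ?thesis
        using bilinear_form_C[OF g(1) X Y] one_form_C[OF \<xi> Y] by (simp add: smooth_functions_iff)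
    qed
  qed
  with X show ?thesis by (rule that)
qed

lemma flat_one_form:
  assumes "bilinear_form M A g" "X \<in> \<X>"
  shows "flat M A g X \<in> one_forms M A"
  using assms unfolding one_forms_def flat_def bilinear_form_def
  by (auto simp: vfield_add vfield_fmult)

text \<open>Since \<open>sharp\<close> is an \<open>inv_into\<close>, this is what makes it a
  two-sided inverse. Surjectivity is \<open>riesz\<close>; for injectivity, nondegeneracy yields
  equal values on the manifold and the normalisation to 0 yields them elsewhere.\<close>

lemma flat_bij_betw:
  assumes g: "bilinear_form M A g" "nondegenerate M A g"
  shows "bij_betw (flat M A g) \<X> (one_forms M A)"
proof (rule bij_betw_imageI)
  show "inj_on (flat M A g) \<X>"
  proof (rule inj_onI)
    fix X Y assume X: "X \<in> \<X>" and Y: "Y \<in> \<X>" and eq: "flat M A g X = flat M A g Y"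
    have gXY: "g X Z = g Y Z" if "Z \<in> \<X>" for Z
      using fun_cong[OF eq, of Z] that by (simp add: flat_def)
    show "X = Y"
    proof (intro ext)
      fix f p
      consider "f \<notin> C" | "f \<in> C" "p \<notin> topspace M" | "f \<in> C" "p \<in> topspace M" by blast
      then show "X f p = Y f p"
      proof cases
        case 1
        then show ?thesis by (simp add: vfield_outside[OF X 1] vfield_outside[OF Y 1])
      next
        case 2
        then show ?thesis
          using vfield_C[OF X 2(1)] vfield_C[OF Y 2(1)] by (simp add: smooth_functions_iff)
      next
        case 3
        then show ?thesis by (intro nondegenerate_eqI[OF g X Y 3(2) _ 3(1)]) (simp add: gXY)
      qed
    qed
  qed
  show "flat M A g ` \<X> = one_forms M A"
  proof (intro equalityI subsetI)
    fix \<xi> assume "\<xi> \<in> flat M A g ` \<X>"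
    then show "\<xi> \<in> one_forms M A" using flat_one_form[OF g(1)] by blast
  next
    fix \<xi> assume \<xi>: "\<xi> \<in> one_forms M A"
    obtain X where X: "X \<in> \<X>" "\<And>Y. Y \<in> \<X> \<Longrightarrow> g X Y = \<xi> Y"
      by (rule riesz[OF g \<xi>]) blast
    have "flat M A g X Y = \<xi> Y" for Y
      using X(2) \<xi> by (auto simp: flat_def one_forms_def)
    then show "\<xi> \<in> flat M A g ` \<X>" using X(1) by (intro image_eqI[of _ _ X]) auto
  qed
qed

end

section \<open>The triple structures\<close>

lemma fmult_uminus: "f \<cdot>\<^sub>F (- T) = - (f \<cdot>\<^sub>F T)"
  by (simp add: fmult_def fun_eq_iff)

lemma additive_uminus:
  fixes T :: "'b::ab_group_add \<Rightarrow> 'c::ab_group_add"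
  assumes "\<And>x y. x \<in> S \<Longrightarrow> y \<in> S \<Longrightarrow> T (x + y) = T x + T y" "\<And>x. x \<in> S \<Longrightarrow> - x \<in> S" "0 \<in> S" "x \<in> S"
  shows "T (- x) = - T x"
proof -
  have "T 0 = 0" using assms(1)[of 0 0] assms(3) by simp
  then show ?thesis using assms(1)[of x "- x"] assms(2,4) by (simp add: minus_unique)
qed

context manifold
begin

abbreviation "\<Omega> \<equiv> one_forms M A"

section \<open>Module operations on fields and 1-forms\<close>

lemma vfield_uminus:
  assumes "X \<in> \<X>"
  shows "- X \<in> \<X>"
proof -
  have "- X = (\<lambda>_. - 1) \<cdot>\<^sub>F X" by (simp add: fmult_def fun_eq_iff)
  then show ?thesis using vfield_scale_closed[OF assms] by simp
qed

lemma one_form_add: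
  assumes "\<xi> \<in> \<Omega>" "\<eta> \<in> \<Omega>"
  shows "\<xi> + \<eta> \<in> \<Omega>"
  using assms unfolding one_forms_def by (auto simp: C_add algebra_simps)

lemma one_form_fmult_closed:
  assumes "\<xi> \<in> \<Omega>" "\<And>h. h \<in> C \<Longrightarrow> f * h \<in> C"
  shows "f \<cdot>\<^sub>F \<xi> \<in> \<Omega>"
  using assms unfolding one_forms_def fmult_def by (auto simp: distrib_left mult.left_commute)

lemma one_form_fmult: "f \<in> C \<Longrightarrow> \<xi> \<in> \<Omega> \<Longrightarrow> f \<cdot>\<^sub>F \<xi> \<in> \<Omega>"
  by (rule one_form_fmult_closed) (auto intro: C_mult C_smooth_in_charts)

lemma one_form_uminus:
  assumes "\<xi> \<in> \<Omega>"
  shows "- \<xi> \<in> \<Omega>"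
proof -
  have "- \<xi> = (\<lambda>_. - 1) \<cdot>\<^sub>F \<xi>" by (simp add: fmult_def fun_eq_iff)
  then show ?thesis using one_form_fmult_closed[OF assms, of "\<lambda>_. - 1"] C_scale by simp
qed

end

locale product_metric_manifold = manifold M A
  for M :: "'a topology" and A :: "('a, 'e::euclidean_space) chart set" +
  fixes F :: "'a vfield \<Rightarrow> 'a vfield" and g :: "'a vfield \<Rightarrow> 'a vfield \<Rightarrow> 'a sfun" and \<epsilon> :: real
  assumes metric: "metric_manifold 1 \<epsilon> M A F g"
begin

abbreviation "\<phi> \<equiv> fundamental_tensor F g"
abbreviation "fl \<equiv> flat M A g"
abbreviation "sh \<equiv> sharp M A g"

section \<open>Linearity of F and of the musical isomorphism of g\<close>

lemma bilinear: "bilinear_form M A g" and nondeg: "nondegenerate M A g"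
  and endo: "vfield_endomorphism M A F"
  and isometry: "X \<in> \<X> \<Longrightarrow> Y \<in> \<X> \<Longrightarrow> g (F X) (F Y) = (\<lambda>_. \<epsilon>) * g X Y"
  using metric by (auto simp: metric_manifold_def pseudo_riemannian_metric_def)

lemma F_involution: "X \<in> \<X> \<Longrightarrow> F (F X) = X"
  using metric by (simp add: metric_manifold_def fmult_def fun_eq_iff)

lemma F_closed: "X \<in> \<X> \<Longrightarrow> F X \<in> \<X>"
  and F_add: "X \<in> \<X> \<Longrightarrow> Y \<in> \<X> \<Longrightarrow> F (X + Y) = F X + F Y"
  and F_fmult: "f \<in> C \<Longrightarrow> X \<in> \<X> \<Longrightarrow> F (f \<cdot>\<^sub>F X) = f \<cdot>\<^sub>F F X"
  using endo by (auto simp: vfield_endomorphism_def)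

lemma fl_bij: "bij_betw fl \<X> \<Omega>"
  by (rule flat_bij_betw[OF bilinear nondeg])

lemma fl_closed: "X \<in> \<X> \<Longrightarrow> fl X \<in> \<Omega>"
  by (rule flat_one_form[OF bilinear])

lemma sh_closed: "\<xi> \<in> \<Omega> \<Longrightarrow> sh \<xi> \<in> \<X>"
  unfolding sharp_def using fl_bij by (metis bij_betw_def inv_into_into)

lemma fl_sh: "\<xi> \<in> \<Omega> \<Longrightarrow> fl (sh \<xi>) = \<xi>"
  unfolding sharp_def by (rule bij_betw_inv_into_right[OF fl_bij])

lemma sh_fl: "X \<in> \<X> \<Longrightarrow> sh (fl X) = X"
  unfolding sharp_def by (rule bij_betw_inv_into_left[OF fl_bij])

lemma fl_add: "X \<in> \<X> \<Longrightarrow> Y \<in> \<X> \<Longrightarrow> fl (X + Y) = fl X + fl Y"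
  using bilinear by (simp add: flat_def fun_eq_iff bilinear_form_def)

lemma fl_fmult: "f \<in> C \<Longrightarrow> X \<in> \<X> \<Longrightarrow> fl (f \<cdot>\<^sub>F X) = f \<cdot>\<^sub>F fl X"
  using bilinear by (simp add: flat_def fun_eq_iff bilinear_form_def fmult_def)

text \<open>The inverse of an additive bijection is additive; the same transfer gives the rules for
  multiples and negatives.\<close>

lemma sh_add:
  assumes "\<xi> \<in> \<Omega>" "\<eta> \<in> \<Omega>"
  shows "sh (\<xi> + \<eta>) = sh \<xi> + sh \<eta>"
  using sh_fl[OF vfield_add[OF sh_closed sh_closed], OF assms] assms by (simp add: fl_add sh_closed fl_sh)

lemma sh_fmult:
  assumes "f \<in> C" "\<xi> \<in> \<Omega>"
  shows "sh (f \<cdot>\<^sub>F \<xi>) = f \<cdot>\<^sub>F sh \<xi>"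
  using sh_fl[OF vfield_fmult[OF assms(1) sh_closed[OF assms(2)]]] assms
  by (simp add: fl_fmult sh_closed fl_sh)

lemma F_uminus: "X \<in> \<X> \<Longrightarrow> F (- X) = - F X"
  using additive_uminus[of \<X> F] F_add vfield_uminus vfield_zero by blast

lemma fl_uminus: "X \<in> \<X> \<Longrightarrow> fl (- X) = - fl X"
  using additive_uminus[of \<X> fl] fl_add vfield_uminus vfield_zero by blast

lemma sh_uminus:
  assumes "\<xi> \<in> \<Omega>"
  shows "sh (- \<xi>) = - sh \<xi>"
  using sh_fl[OF vfield_uminus[OF sh_closed[OF assms]]] assms by (simp add: fl_uminus sh_closed fl_sh)

section \<open>The fundamental tensor and the dual map\<close>

lemma flat_fundamental: "flat M A \<phi> X = fl (F X)"
  by (simp add: flat_def fundamental_tensor_def)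

text \<open>\<open>flat M A \<phi>\<close> is \<open>fl\<close> composed with the involution
  \<open>F\<close>, so injectivity and the preimage both come from \<open>fl\<close>, without a
  second nondegeneracy argument.\<close>

lemma sharp_fundamental:
  assumes "\<xi> \<in> \<Omega>"
  shows "sharp M A \<phi> \<xi> = F (sh \<xi>)"
proof -
  have "inj_on (flat M A \<phi>) \<X>"
    by (rule inj_on_inverseI[of _ "\<lambda>\<xi>. F (sh \<xi>)"])
      (simp add: flat_fundamental F_closed sh_fl F_involution)
  moreover have "flat M A \<phi> (F (sh \<xi>)) = \<xi>"
    using assms by (simp add: flat_fundamental F_involution sh_closed fl_sh)
  ultimately show ?thesis
    unfolding sharp_def using F_closed[OF sh_closed[OF assms]]
    by (metis inv_into_f_f sharp_def)
qed

text \<open>Since \<open>g(FX, Y) = \<epsilon> g(X, FY)\<close>, the map \<open>\<epsilon> F*\<close> is \<open>F\<close> transported by the musical isomorphism.\<close>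

lemma dual_map_conjugate:
  assumes "\<xi> \<in> \<Omega>"
  shows "(\<lambda>_. \<epsilon>) \<cdot>\<^sub>F dual_map M A F \<xi> = fl (F (sh \<xi>))"
proof
  fix Y
  define X where "X = sh \<xi>"
  have X: "X \<in> \<X>" "\<xi> = fl X" using assms by (simp_all add: X_def sh_closed fl_sh)
  show "((\<lambda>_. \<epsilon>) \<cdot>\<^sub>F dual_map M A F \<xi>) Y = fl (F (sh \<xi>)) Y"
  proof (cases "Y \<in> \<X>")
    case True
    \<comment> \<open>Write \<open>Y\<close> as \<open>F (F Y)\<close> and use the isometry
      condition.\<close>
    have "g (F X) Y = (\<lambda>_. \<epsilon>) * g X (F Y)"
      using isometry[OF X(1) F_closed[OF True]] F_involution[OF True] by simp
    moreover have "((\<lambda>_. \<epsilon>) \<cdot>\<^sub>F dual_map M A F \<xi>) Y = (\<lambda>_. \<epsilon>) * g X (F Y)"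
      using True F_closed[OF True] by (simp add: fmult_def dual_map_def X(2) flat_def)
    moreover have "fl (F (sh \<xi>)) Y = g (F X) Y" using True by (simp add: flat_def X_def)
    ultimately show ?thesis by simp
  qed (simp add: fmult_def dual_map_def flat_def fun_eq_iff)
qed

section \<open>The operators on sections, and the four triples\<close>

lemma gen_F_g: "gen_F M A g (X, \<xi>) = (sh \<xi>, fl X)"
  and gen_J_g: "gen_J M A g (X, \<xi>) = (- sh \<xi>, fl X)"
  by (simp_all add: gen_F_def gen_J_def block_def)

lemma gen_ops:
  assumes "\<xi> \<in> \<Omega>"
  shows "gen_F M A \<phi> (X, \<xi>) = (F (sh \<xi>), fl (F X))"
    and "gen_J M A \<phi> (X, \<xi>) = (- F (sh \<xi>), fl (F X))"
    and "gen_diag M A \<epsilon> F (X, \<xi>) = (F X, fl (F (sh \<xi>)))"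
    and "gen_diag M A (- \<epsilon>) F (X, \<xi>) = (F X, - fl (F (sh \<xi>)))"
proof -
  show "gen_F M A \<phi> (X, \<xi>) = (F (sh \<xi>), fl (F X))" "gen_J M A \<phi> (X, \<xi>) = (- F (sh \<xi>), fl (F X))"
    by (simp_all add: gen_F_def gen_J_def block_def flat_fundamental sharp_fundamental[OF assms])
  show "gen_diag M A \<epsilon> F (X, \<xi>) = (F X, fl (F (sh \<xi>)))"
    by (simp add: gen_diag_def block_def dual_map_conjugate[OF assms])
  have "(\<lambda>_. - \<epsilon>) \<cdot>\<^sub>F dual_map M A F \<xi> = - fl (F (sh \<xi>))"
    unfolding dual_map_conjugate[OF assms, symmetric] by (simp add: fmult_def fun_eq_iff)
  then show "gen_diag M A (- \<epsilon>) F (X, \<xi>) = (F X, - fl (F (sh \<xi>)))"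
    by (simp add: gen_diag_def block_def)
qed

lemmas closed = F_closed fl_closed sh_closed vfield_uminus one_form_uminus vfield_add one_form_add
  vfield_fmult one_form_fmult
lemmas inverses = F_involution fl_sh sh_fl F_uminus fl_uminus sh_uminus
lemmas linear = F_add fl_add sh_add F_fmult fl_fmult sh_fmult fmult_uminus
lemmas operators = gen_F_g gen_J_g gen_ops

lemma gen_endomorphisms:
  "gen_endomorphism M A (gen_F M A g)" "gen_endomorphism M A (gen_J M A g)"
  "gen_endomorphism M A (gen_F M A \<phi>)" "gen_endomorphism M A (gen_J M A \<phi>)"
  "gen_endomorphism M A (gen_diag M A \<epsilon> F)" "gen_endomorphism M A (gen_diag M A (- \<epsilon>) F)"
  "gen_endomorphism M A (- gen_diag M A \<epsilon> F)"
  unfolding gen_endomorphism_def gsections_def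
  by (auto simp: operators closed linear)

text \<open>Identify 1-forms with fields by \<open>sh\<close>. Each operator then is a real 2 by 2
  matrix times 1 or \<open>F\<close>. Let \<open>s\<close> be the swap of the two components,
  \<open>k = diag(1, -1)\<close> and \<open>j = s k\<close>, so that \<open>j\<close> sends
  \<open>(X, Z)\<close> to \<open>(-Z, X)\<close>. The operators \<open>gen_F\<close> and
  \<open>gen_J\<close> are \<open>s\<close> and \<open>j\<close> for \<open>g\<close>, and
  \<open>s F\<close> and \<open>j F\<close> for \<open>\<phi>\<close>; the diagonal ones are
  \<open>F\<close> for the sign \<open>\<epsilon>\<close> and \<open>k F\<close> for
  \<open>- \<epsilon>\<close>. This triple is \<open>(s, F, s F)\<close>, and \<open>F\<close>
  commutes with every matrix.\<close>

lemma hyperproduct: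
  "generalized_almost_hyperproduct M A (gen_F M A g) (gen_diag M A \<epsilon> F) (gen_F M A \<phi>)"
  unfolding generalized_almost_hyperproduct_def generalized_triple_structure_def pairwise_commute_def
  by (auto simp: gen_endomorphisms gen_eq_def gsections_def operators closed inverses)

text \<open>In the same notation the triple \<open>(s, k F, j F)\<close>: here
  \<open>s k = j\<close>, and the matrices \<open>s\<close>, \<open>k\<close>, \<open>j\<close>
  anticommute pairwise with squares \<open>1\<close>, \<open>1\<close>, \<open>-1\<close>.\<close>

lemma biparacomplex_g:
  "generalized_almost_biparacomplex M A (gen_F M A g) (gen_diag M A (- \<epsilon>) F) (gen_J M A \<phi>)"
  unfolding generalized_almost_biparacomplex_def generalized_triple_structure_def pairwise_anticommute_def
  by (auto simp: gen_endomorphisms gen_eq_def gsections_def operators closed inverses)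

text \<open>The triple \<open>(s F, k F, j)\<close>, again from \<open>s k = j\<close>, the two
  factors \<open>F\<close> cancelling.\<close>

lemma biparacomplex_fundamental:
  "generalized_almost_biparacomplex M A (gen_F M A \<phi>) (gen_diag M A (- \<epsilon>) F) (gen_J M A g)"
  unfolding generalized_almost_biparacomplex_def generalized_triple_structure_def pairwise_anticommute_def
  by (auto simp: gen_endomorphisms gen_eq_def gsections_def operators closed inverses)

text \<open>The triple \<open>(j, j F, - F)\<close>: all three are built from the commuting
  \<open>j\<close> and \<open>F\<close>, and the minus sign is \<open>j^2 = -1\<close>.\<close>

lemma bicomplex:
  "generalized_almost_bicomplex M A (gen_J M A g) (gen_J M A \<phi>) (- gen_diag M A \<epsilon> F)"
  unfolding generalized_almost_bicomplex_def generalized_triple_structure_def pairwise_commute_def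
  by (auto simp: gen_endomorphisms gen_eq_def gsections_def operators closed inverses)

end

theorem proposition5p8:
  fixes M :: "'a topology"
    and A :: "('a, 'e::euclidean_space) chart set"
    and F :: "'a vfield \<Rightarrow> 'a vfield"
    and g \<phi> :: "'a vfield \<Rightarrow> 'a vfield \<Rightarrow> 'a sfun"
    and \<alpha> \<epsilon> :: real
  assumes "metric_manifold \<alpha> \<epsilon> M A F g"
    and "\<alpha> = 1"
    and "\<phi> = fundamental_tensor F g"
  shows "generalized_almost_hyperproduct M A (gen_F M A g) (gen_diag M A \<epsilon> F) (gen_F M A \<phi>) \<and>
         generalized_almost_biparacomplex M A (gen_F M A g) (gen_diag M A (- \<epsilon>) F) (gen_J M A \<phi>) \<and>
         generalized_almost_biparacomplex M A (gen_F M A \<phi>) (gen_diag M A (- \<epsilon>) F) (gen_J M A g) \<and>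
         generalized_almost_bicomplex M A (gen_J M A g) (gen_J M A \<phi>) (- gen_diag M A \<epsilon> F)"
proof -
  interpret product_metric_manifold M A F g \<epsilon>
    using assms(1,2) by unfold_locales (simp_all add: metric_manifold_def)
  show ?thesis
    unfolding assms(3) using hyperproduct biparacomplex_g biparacomplex_fundamental bicomplex by blast
qed

end
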